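(* Let $p_{[w]}$ be a flow-up class for $[w]\in W/W_J$ in $H^*_T(G/P)$ and let $s_i$ be a simple reflection. Then \[s_i \cdot p_{[w]} = \begin{cases} p_{[w]} & \text{if } [s_iw] \geq_P [w], \\ p_{[w]}-\alpha_i\,p_{[s_iw]} & \text{if } [s_iw]<_P [w]. \end{cases}\]
   Context: $G$ is a complex semisimple linear algebraic group, $T \subseteq B \subseteq P \subseteq G$ with $T$ a maximal torus, $B$ a Borel subgroup, $P$ a parabolic subgroup; $\mathfrak{t} = \mathrm{Lie}(T)$. $W=N(T)/T$ is the Weyl group, $\Delta$ the roots, $\Delta^+$ the positive roots (those of $B$), $\alpha_1,\dots,\alpha_n$ the simple roots, $s_1,\dots,s_n$ the simple reflections, $s_\alpha$ the reflection in $\alpha$. $J \subseteq \{1,\dots,n\}$ is the subset corresponding to $P$ (so $i\in J$ iff $\mathfrak{g}_{-\alpha_i} \subseteq \mathrm{Lie}(P)$), $W_J = \langle s_i : i \in J\rangle$, $[w]=wW_J \in W/W_J$, and $\le_P$ is the Bruhat order on $W/W_J$, i.e. the Bruhat order of $W$ on unique minimal-length coset representatives. $S(\mathfrak{t}^* )$ is the symmetric algebra over $\mathbb{C}$, on which $W$ acts by algebra automorphisms extending its action on $\mathfrak{t}^*$. Cohomology has complex coefficients, and $H^*_T(G/P)$ is given in its GKM presentation: it is the ring (coordinatewise operations) of functions $p : W/W_J \to S(\mathfrak{t}^* )$ such that $p([s_\alpha w]) - p([w]) \in (\alpha)$ for all $w \in W$ and $\alpha\in\Delta^+$ with $[s_\alpha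 w] \neq [w]$. The group $W$ acts on $H^*_T(G/P)$ by $(w \cdot p)([v]) = w\big(p([w^{-1}v])\big)$. Moment graph of $G/P$: vertices $W/W_J$; for $\alpha \in \Delta^+$ there is an edge labeled $\alpha$ between $[w]$ and $[s_\alpha w]$ whenever $[s_\alpha w]\neq [w]$, directed $[w] \mapsto [s_\alpha w]$ if $w^{-1}(\alpha)<0$ and $[s_\alpha w]\mapsto [w]$ otherwise. A flow-up (equivariant Schubert) class $p_{[w]} \in H^*_T(G/P)$ is a homogeneous class supported exactly on the $[v]$ with $[v] \ge_P [w]$ and with $p_{[w]}([w])$ equal to the product of the labels of all edges directed out of $[w]$. Flow-up classes exist for all $[w]$ and form an $S(\mathfrak{t}^* )$-module basis of $H^*_T(G/P)$. *)

theory Defs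
  imports "HOL-Analysis.Analysis" "HOL-Library.Poly_Mapping"
begin

section \<open>Based root systems\<close>

text \<open>
  The triple (G, B, T) enters only through its based root system. For semisimple G of rank n, \<open>'n\<close> is an
  index type with n elements; it indexes both the coordinates of the complex vector space
  \<open>t\<^sup>* = complex ^ 'n\<close> and the simple roots, which form a basis of \<open>t\<^sup>*\<close>. Coroots live in \<open>t\<close>, which
  is identified with \<open>complex ^ 'n\<close> through the coordinatewise pairing \<^const>\<open>scalar_product\<close>.
  A parabolic P containing B is given by the set \<open>J\<close> of those i for which the root space of the negative
  of the i-th simple root lies in Lie(P).
\<close>

record 'n root_data =
  roots :: "(complex ^ 'n) set"
  coroot :: "complex ^ 'n \<Rightarrow> complex ^ 'n"
  simple :: "'n \<Rightarrow> complex ^ 'n"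

definition refl_root :: "'n::finite root_data \<Rightarrow> complex ^ 'n \<Rightarrow> complex ^ 'n \<Rightarrow> complex ^ 'n" where
  "refl_root D \<alpha> x = x - scalar_product x (coroot D \<alpha>) *s \<alpha>"

abbreviation simple_refl :: "'n::finite root_data \<Rightarrow> 'n \<Rightarrow> complex ^ 'n \<Rightarrow> complex ^ 'n" where
  "simple_refl D i \<equiv> refl_root D (simple D i)"

definition positive_roots :: "'n::finite root_data \<Rightarrow> (complex ^ 'n) set" where
  "positive_roots D =
     {\<beta> \<in> roots D. \<exists>c :: 'n \<Rightarrow> nat. \<beta> = (\<Sum>i\<in>UNIV. of_nat (c i) *s simple D i)}"

definition root_system :: "'n::finite root_data \<Rightarrow> bool" where
  "root_system D \<longleftrightarrow>
     finite (roots D) \<and> 0 \<notin> roots D \<and> vec.span (roots D) = UNIV \<and>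
     (\<forall>\<alpha>\<in>roots D. scalar_product \<alpha> (coroot D \<alpha>) = 2) \<and>
     (\<forall>\<alpha>\<in>roots D. refl_root D \<alpha> ` roots D = roots D) \<and>
     (\<forall>\<alpha>\<in>roots D. \<forall>\<beta>\<in>roots D. scalar_product \<beta> (coroot D \<alpha>) \<in> \<int>) \<and>
     (\<forall>\<alpha>\<in>roots D. \<forall>c. c *s \<alpha> \<in> roots D \<longrightarrow> c = 1 \<or> c = -1)"

definition is_base :: "'n::finite root_data \<Rightarrow> bool" where
  "is_base D \<longleftrightarrow>
     inj (simple D) \<and> range (simple D) \<subseteq> roots D \<and> vec.independent (range (simple D)) \<and>
     (\<forall>\<beta>\<in>roots D. \<beta> \<in> positive_roots D \<or> - \<beta> \<in> positive_roots D)"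

definition based_root_system :: "'n::finite root_data \<Rightarrow> bool" where
  "based_root_system D \<longleftrightarrow> root_system D \<and> is_base D"


section \<open>Weyl group, parabolic cosets and Bruhat order\<close>

text \<open>
  Elements of the Weyl group are represented by their (faithful) action on \<open>t\<^sup>*\<close>. The generating
  sets below consist of involutions, so the monoid they generate is the group they generate.
\<close>

inductive_set generated :: "('v \<Rightarrow> 'v) set \<Rightarrow> ('v \<Rightarrow> 'v) set" for S where
  "id \<in> generated S"
| "s \<in> S \<Longrightarrow> w \<in> generated S \<Longrightarrow> s \<circ> w \<in> generated S"

definition weyl :: "'n::finite root_data \<Rightarrow> (complex ^ 'n \<Rightarrow> complex ^ 'n) set" where
  "weyl D = generated (refl_root D ` roots D)"

definition weyl_parabolic :: "'n::finite root_data \<Rightarrow> 'n set \<Rightarrow> (complex ^ 'n \<Rightarrow> complex ^ 'n) set" where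
  "weyl_parabolic D J = generated (simple_refl D ` J)"

type_synonym 'n coset = "(complex ^ 'n \<Rightarrow> complex ^ 'n) set"

definition coset :: "'n::finite root_data \<Rightarrow> 'n set \<Rightarrow> (complex ^ 'n \<Rightarrow> complex ^ 'n) \<Rightarrow> 'n coset" where
  "coset D J w = (\<lambda>u. w \<circ> u) ` weyl_parabolic D J"

definition cosets :: "'n::finite root_data \<Rightarrow> 'n set \<Rightarrow> 'n coset set" where
  "cosets D J = coset D J ` weyl D"

definition weyl_length :: "'n::finite root_data \<Rightarrow> (complex ^ 'n \<Rightarrow> complex ^ 'n) \<Rightarrow> nat" where
  "weyl_length D w = (LEAST k. \<exists>is. length is = k \<and> w = foldr (\<lambda>i v. simple_refl D i \<circ> v) is id)"

definition bruhat ::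
    "'n::finite root_data \<Rightarrow> (complex ^ 'n \<Rightarrow> complex ^ 'n) \<Rightarrow> (complex ^ 'n \<Rightarrow> complex ^ 'n) \<Rightarrow> bool" where
  "bruhat D = (\<lambda>u v. u \<in> weyl D \<and>
     (\<exists>\<alpha>\<in>roots D. v = refl_root D \<alpha> \<circ> u) \<and> weyl_length D u < weyl_length D v)\<^sup>*\<^sup>*"

definition is_min_rep :: "'n::finite root_data \<Rightarrow> (complex ^ 'n \<Rightarrow> complex ^ 'n) \<Rightarrow> 'n coset \<Rightarrow> bool" where
  "is_min_rep D u X \<longleftrightarrow> u \<in> X \<and> (\<forall>v\<in>X. weyl_length D u \<le> weyl_length D v)"

definition coset_le :: "'n::finite root_data \<Rightarrow> 'n coset \<Rightarrow> 'n coset \<Rightarrow> bool" where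
  "coset_le D X Y \<longleftrightarrow> (\<exists>u v. is_min_rep D u X \<and> is_min_rep D v Y \<and> bruhat D u v)"

definition coset_less :: "'n::finite root_data \<Rightarrow> 'n coset \<Rightarrow> 'n coset \<Rightarrow> bool" where
  "coset_less D X Y \<longleftrightarrow> coset_le D X Y \<and> X \<noteq> Y"


section \<open>The symmetric algebra\<close>

text \<open>
  The symmetric algebra of \<open>t\<^sup>* = complex ^ 'n\<close> is the polynomial ring over \<open>\<complex>\<close> in one variable for
  each standard basis vector \<^term>\<open>axis i 1\<close>: monomials are exponent vectors \<open>'n \<Rightarrow>\<^sub>0 nat\<close>.
  \<open>sym_of\<close> is the inclusion of \<open>t\<^sup>*\<close> as the linear forms.
\<close>

type_synonym 'n sym = "('n \<Rightarrow>\<^sub>0 nat) \<Rightarrow>\<^sub>0 complex"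

definition sym_of :: "complex ^ 'n \<Rightarrow> 'n sym" where
  "sym_of v = (\<Sum>i\<in>UNIV. Poly_Mapping.single (Poly_Mapping.single i 1) (v $ i))"

text \<open>
  The algebra endomorphism induced by a linear endomorphism of \<open>t\<^sup>*\<close>
  (see \<open>sym_map_sym_of\<close>, \<open>sym_map_add\<close>, \<open>sym_map_mult\<close> and \<open>sym_map_const\<close> below).
\<close>

definition sym_map :: "(complex ^ 'n \<Rightarrow> complex ^ 'n) \<Rightarrow> 'n sym \<Rightarrow> 'n sym" where
  "sym_map f p =
     (\<Sum>m\<in>Poly_Mapping.keys p. Poly_Mapping.single 0 (Poly_Mapping.lookup p m) *
        (\<Prod>i\<in>UNIV. sym_of (f (axis i 1)) ^ Poly_Mapping.lookup m i))"

definition homogeneous :: "nat \<Rightarrow> 'n::finite sym \<Rightarrow> bool" where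
  "homogeneous d p \<longleftrightarrow>
     (\<forall>m\<in>Poly_Mapping.keys p. (\<Sum>i\<in>UNIV. Poly_Mapping.lookup m i) = d)"

lemma sym_map_superset:
  assumes "finite A" "Poly_Mapping.keys p \<subseteq> A"
  shows "sym_map f p = (\<Sum>m\<in>A. Poly_Mapping.single 0 (Poly_Mapping.lookup p m) *
        (\<Prod>i\<in>UNIV. sym_of (f (axis i 1)) ^ Poly_Mapping.lookup m i))"
  unfolding sym_map_def
  by (rule sum.mono_neutral_left) (use assms in \<open>auto simp: in_keys_iff\<close>)

lemma sym_map_add: "sym_map f (p + q) = sym_map f p + sym_map f q"
proof -
  let ?A = "Poly_Mapping.keys p \<union> Poly_Mapping.keys q"
  have "finite ?A" by simp
  moreover have "Poly_Mapping.keys (p + q) \<subseteq> ?A" by (rule Poly_Mapping.keys_add)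
  ultimately show ?thesis
    by (simp add: sym_map_superset[of ?A] lookup_add single_add distrib_right sum.distrib)
qed

lemma sym_map_sum: "sym_map f (\<Sum>x\<in>A. g x) = (\<Sum>x\<in>A. sym_map f (g x))"
  by (induction A rule: infinite_finite_induct) (simp_all add: sym_map_add, simp_all add: sym_map_def)

lemma sym_map_single:
  "sym_map f (Poly_Mapping.single m c) =
     Poly_Mapping.single 0 c * (\<Prod>i\<in>UNIV. sym_of (f (axis i 1)) ^ Poly_Mapping.lookup m i)"
  by (simp add: sym_map_superset[of "{m}"])

lemma sym_map_const: "sym_map f (Poly_Mapping.single 0 c) = Poly_Mapping.single 0 c"
  by (simp add: sym_map_single)

lemma sym_eq_sum_single:
  "(p :: 'n::finite sym) =
     (\<Sum>m\<in>Poly_Mapping.keys p. Poly_Mapping.single m (Poly_Mapping.lookup p m))"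
  by (rule poly_mapping_eqI)
     (simp add: lookup_sum lookup_single when_def in_keys_iff)

lemma sym_map_mult: "sym_map f (p * q) = sym_map f p * sym_map f q"
proof -
  let ?s = Poly_Mapping.single and ?l = Poly_Mapping.lookup and ?k = Poly_Mapping.keys
  have single: "sym_map f (?s m a * ?s m' b) = sym_map f (?s m a) * sym_map f (?s m' b)"
    for m m' a b
    by (simp add: mult_single sym_map_single lookup_add power_add prod.distrib)
       (metis (no_types, lifting) add_0 mult.assoc mult.left_commute mult_single)
  have "sym_map f (p * q) =
      sym_map f ((\<Sum>m\<in>?k p. ?s m (?l p m)) * (\<Sum>m\<in>?k q. ?s m (?l q m)))"
    using sym_eq_sum_single[of p] sym_eq_sum_single[of q] by simp
  also have "\<dots> = sym_map f (\<Sum>m\<in>?k p. ?s m (?l p m)) * sym_map f (\<Sum>m\<in>?k q. ?s m (?l q m))"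
    by (simp only: sum_product sym_map_sum single)
  also have "\<dots> = sym_map f p * sym_map f q"
    using sym_eq_sum_single[of p] sym_eq_sum_single[of q] by simp
  finally show ?thesis .
qed

lemma sym_of_add: "sym_of (u + v) = sym_of u + sym_of v"
  by (simp add: sym_of_def single_add sum.distrib)

lemma sym_of_scale: "sym_of (c *s v) = Poly_Mapping.single 0 c * sym_of v"
  by (simp add: sym_of_def sum_distrib_left mult_single)

lemma sym_of_sum: "sym_of (\<Sum>x\<in>A. g x) = (\<Sum>x\<in>A. sym_of (g x))"
  by (induction A rule: infinite_finite_induct)
     (simp_all add: sym_of_add, simp_all add: sym_of_def)

lemma sym_map_sym_of:
  assumes "Vector_Spaces.linear (*s) (*s) f"
  shows "sym_map f (sym_of v) = sym_of (f v)"
proof -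
  interpret f: Vector_Spaces.linear "(*s)" "(*s)" f by fact
  have "(\<Prod>j\<in>UNIV. sym_of (f (axis j 1)) ^ Poly_Mapping.lookup (Poly_Mapping.single i 1) j)
      = sym_of (f (axis i 1))" for i
    by (subst prod.remove[of _ i]) (simp_all add: lookup_single when_def)
  then have "sym_map f (sym_of v) =
      (\<Sum>i\<in>UNIV. Poly_Mapping.single 0 (v $ i) * sym_of (f (axis i 1)))"
    by (subst sym_of_def) (simp add: sym_map_sum sym_map_single)
  also have "\<dots> = sym_of (f (\<Sum>i\<in>UNIV. v $ i *s axis i 1))"
    by (simp add: sym_of_scale sym_of_sum f.sum f.scale)
  finally show ?thesis by (simp add: basis_expansion)
qed


section \<open>Equivariant cohomology in the GKM presentation\<close>

text \<open>
  Classes are functions on \<^const>\<open>cosets\<close>; their values on other sets are irrelevant, and two of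
  them are equal as classes if they agree on \<^const>\<open>cosets\<close>.
\<close>

definition gkm_class :: "'n::finite root_data \<Rightarrow> 'n set \<Rightarrow> ('n coset \<Rightarrow> 'n sym) \<Rightarrow> bool" where
  "gkm_class D J p \<longleftrightarrow>
     (\<forall>w\<in>weyl D. \<forall>\<alpha>\<in>positive_roots D. coset D J (refl_root D \<alpha> \<circ> w) \<noteq> coset D J w \<longrightarrow>
        sym_of \<alpha> dvd p (coset D J (refl_root D \<alpha> \<circ> w)) - p (coset D J w))"

definition homogeneous_class ::
    "'n::finite root_data \<Rightarrow> 'n set \<Rightarrow> ('n coset \<Rightarrow> 'n sym) \<Rightarrow> bool" where
  "homogeneous_class D J p \<longleftrightarrow> (\<exists>d. \<forall>X\<in>cosets D J. homogeneous d (p X))"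

text \<open>The image of \<open>[v]\<close> under left composition with \<open>w\<^sup>-\<^sup>1\<close> is \<open>[w\<^sup>-\<^sup>1v]\<close>.\<close>

definition weyl_act ::
    "(complex ^ 'n \<Rightarrow> complex ^ 'n) \<Rightarrow> ('n coset \<Rightarrow> 'n sym) \<Rightarrow> 'n coset \<Rightarrow> 'n sym" where
  "weyl_act w p X = sym_map w (p ((\<lambda>u. inv w \<circ> u) ` X))"

definition moment_edge ::
    "'n::finite root_data \<Rightarrow> 'n set \<Rightarrow> 'n coset \<Rightarrow> complex ^ 'n \<Rightarrow> 'n coset \<Rightarrow> bool" where
  "moment_edge D J X \<alpha> Y \<longleftrightarrow> \<alpha> \<in> positive_roots D \<and>
     (\<exists>w\<in>weyl D. coset D J (refl_root D \<alpha> \<circ> w) \<noteq> coset D J w \<and>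
        (if - inv w \<alpha> \<in> positive_roots D
         then X = coset D J w \<and> Y = coset D J (refl_root D \<alpha> \<circ> w)
         else X = coset D J (refl_root D \<alpha> \<circ> w) \<and> Y = coset D J w))"

definition flow_up_class ::
    "'n::finite root_data \<Rightarrow> 'n set \<Rightarrow> 'n coset \<Rightarrow> ('n coset \<Rightarrow> 'n sym) \<Rightarrow> bool" where
  "flow_up_class D J X p \<longleftrightarrow>
     gkm_class D J p \<and> homogeneous_class D J p \<and>
     (\<forall>Y\<in>cosets D J. p Y \<noteq> 0 \<longleftrightarrow> coset_le D X Y) \<and>
     p X = (\<Prod>(\<alpha>, Y) \<in> {(\<alpha>, Y). moment_edge D J X \<alpha> Y}. sym_of \<alpha>)"

end

theory Submission
  imports Defs
begin

text \<open>
  Let $r = p - s_i p$. At every vertex $r$ is divisible by \<open>\<alpha>\<^sub>i\<close>: the edge condition compares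
  $p([v])$ with $p([s_i v])$ modulo \<open>\<alpha>\<^sub>i\<close>, and $s_i f$ agrees with $f$ modulo \<open>\<alpha>\<^sub>i\<close>. The quotient
  (the left divided difference of $p$) is again a GKM class (\<open>divided_difference\<close>): for a label
  other than \<open>\<alpha>\<^sub>i\<close> one cancels the factor \<open>\<alpha>\<^sub>i\<close>, because linear forms are prime, and for the label
  \<open>\<alpha>\<^sub>i\<close> itself the quotient commutes with $s_i$. Its degree is one less than the degree of $p$.

  The vertices are ranked by the number of edges directed out of them; this is the length of the
  minimal coset representative. A nonzero homogeneous GKM class of degree $e$ is nonzero at some
  vertex of rank at most $e$ (\<open>gkm_support_vertex\<close>): at a support vertex of lowest rank all outgoing
  edges lead to zeros of the class, so its value there is divisible by the product of the outgoing
  labels, which are pairwise non-associated primes.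

  Both cases of the theorem follow by comparing ranks. Since $p$ has degree \<open>d = rank [w]\<close> and lives
  on vertices above $[w]$, the only vertex of rank less than $d$ at which $r$ can be nonzero is
  $[s_i w]$ (\<open>flow_up_class_support_act\<close>). If \<open>[s\<^sub>i w] \<ge> [w]\<close>, that vertex has rank at least $d$, so
  the divided difference, of degree $d - 1$, vanishes. If \<open>[s\<^sub>i w] < [w]\<close>, the divided difference and
  the flow-up class of $[s_i w]$ have degree $d - 1$ and agree at $[s_i w]$, so their difference is
  zero at every vertex of rank less than $d$ and hence vanishes. The Bruhat order enters through
  two facts: the rank increases strictly along it, and $[w]$ and $[s_i w]$ are comparable.

  The facts on Weyl groups behind the rank are derived from the root system: simple reflections
  permute the other positive roots, they generate the Weyl group (by means of an invariant inner
  product), and the exchange property identifies word length with the number of inversions.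
\<close>

section \<open>Algebra maps on the symmetric algebra\<close>

lemma variable_power: "Poly_Mapping.single (Poly_Mapping.single i 1) 1 ^ n
    = (Poly_Mapping.single (Poly_Mapping.single i n) 1 :: 'n::finite sym)"
  by (induction n) (simp_all add: mult_single flip: single_add)

lemma prod_monomial:
  "(\<Prod>i\<in>A. Poly_Mapping.single (a i) 1) = (Poly_Mapping.single (\<Sum>i\<in>A. a i) 1 :: 'n::finite sym)"
  by (induction A rule: infinite_finite_induct) (simp_all add: mult_single)

lemma sym_of_axis: "sym_of (axis i 1) = Poly_Mapping.single (Poly_Mapping.single i 1) 1"
  by (simp add: sym_of_def axis_def if_distrib[of "Poly_Mapping.single _"] sum.delta cong: if_cong)

lemma sym_map_id: "sym_map id p = (p :: 'n::finite sym)"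
proof -
  have "(\<Sum>i\<in>UNIV. Poly_Mapping.single i (Poly_Mapping.lookup m i)) = m" for m :: "'n \<Rightarrow>\<^sub>0 nat"
    by (rule poly_mapping_eqI) (simp add: lookup_sum lookup_single when_def)
  then have "sym_map id (Poly_Mapping.single m c) = Poly_Mapping.single m c" for m :: "'n \<Rightarrow>\<^sub>0 nat" and c
    by (simp add: sym_map_single sym_of_axis variable_power[simplified] prod_monomial mult_single)
  then show ?thesis
    by (subst (1 2) sym_eq_sum_single) (simp add: sym_map_sum)
qed

lemma sym_map_0: "sym_map f 0 = 0"
  by (simp add: sym_map_def)

lemma sym_map_1: "sym_map f 1 = 1"
  using sym_map_const[of f 1] by simp

lemma sym_map_diff: "sym_map f (p - q) = sym_map f p - sym_map f q"
  using sym_map_add[of f "p - q" q] by (simp add: algebra_simps)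

lemma sym_map_power: "sym_map f (p ^ n) = sym_map f p ^ n"
  by (induction n) (simp_all add: sym_map_1 sym_map_mult)

lemma sym_map_prod: "sym_map f (\<Prod>x\<in>A. g x) = (\<Prod>x\<in>A. sym_map f (g x))"
  by (induction A rule: infinite_finite_induct) (simp_all add: sym_map_1 sym_map_mult)

lemma sym_map_compose:
  assumes "Vector_Spaces.linear (*s) (*s) f"
  shows "sym_map f (sym_map g p) = sym_map (f \<circ> g) p"
  by (subst (1 2) sym_map_def)
     (simp add: sym_map_sum sym_map_mult sym_map_const sym_map_prod sym_map_power
        sym_map_sym_of[OF assms])

lemma sym_map_dvd: "p dvd q \<Longrightarrow> sym_map f p dvd sym_map f q"
  by (auto simp: dvd_def sym_map_mult)

lemma sym_of_minus: "sym_of (- v) = - sym_of v"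
  by (simp add: sym_of_def single_uminus sum_negf)

lemma sym_of_diff: "sym_of (u - v) = sym_of u - sym_of v"
  using sym_of_add[of u "- v"] by (simp add: sym_of_minus)

lemma lookup_sym_of: "Poly_Mapping.lookup (sym_of v) (Poly_Mapping.single i 1) = v $ i"
proof -
  have "Poly_Mapping.single j (1::nat) = Poly_Mapping.single i 1 \<longleftrightarrow> j = i" for j
    by (metis lookup_single_eq lookup_single_not_eq zero_neq_one)
  then show ?thesis
    by (simp add: sym_of_def lookup_sum lookup_single when_def)
qed

lemma sym_of_eq_0_iff: "sym_of v = 0 \<longleftrightarrow> v = 0"
proof
  assume "sym_of v = 0"
  then show "v = 0" using lookup_sym_of[of v] by (simp add: vec_eq_iff)
qed (simp add: sym_of_def)


section \<open>Linear forms as prime elements\<close>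

lemma lookup_single_mult:
  "Poly_Mapping.lookup (Poly_Mapping.single a c * f) k =
     c * (\<Sum>q. Poly_Mapping.lookup f q when k = a + q)" for f :: "'n::finite sym"
  by (simp add: lookup_mult lookup_single when_mult)

text \<open>
  Pick a variable that occurs in the form and a monomial of \<open>f\<close> in which this variable has the
  largest exponent. Their product arises in only one way as a monomial of the product of the two
  polynomials, so its coefficient cannot cancel.
\<close>

lemma linear_form_mult_eq_0:
  fixes f :: "'n::finite sym"
  assumes prod: "sym_of v * f = 0" and v: "v \<noteq> 0"
  shows "f = 0"
proof (rule ccontr)
  assume "f \<noteq> 0"
  let ?l = Poly_Mapping.lookup
  obtain i where i: "v $ i \<noteq> 0" using v by (auto simp: vec_eq_iff)
  define deg where "deg m = ?l m i" for m :: "'n \<Rightarrow>\<^sub>0 nat"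
  have "Max (deg ` Poly_Mapping.keys f) \<in> deg ` Poly_Mapping.keys f"
    using \<open>f \<noteq> 0\<close> by (intro Max_in) (auto simp: keys_eq_empty)
  then obtain m where m: "m \<in> Poly_Mapping.keys f"
    and "deg m = Max (deg ` Poly_Mapping.keys f)" by auto
  then have max: "deg q \<le> deg m" if "q \<in> Poly_Mapping.keys f" for q
    using that by simp
  define k where "k = m + Poly_Mapping.single i 1"
  have other: "(\<Sum>q. ?l f q when k = Poly_Mapping.single j 1 + q) = 0" if "j \<noteq> i" for j
  proof -
    have "(?l f q when k = Poly_Mapping.single j 1 + q) = 0" for q
    proof (cases "k = Poly_Mapping.single j 1 + q")
      case True
      have "deg q = Suc (deg m)"
        using arg_cong[OF True, of deg] \<open>j \<noteq> i\<close> by (simp add: deg_def k_def lookup_add lookup_single)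
      then have "q \<notin> Poly_Mapping.keys f" using max[of q] by auto
      then show ?thesis by (simp add: in_keys_iff)
    qed simp
    then show ?thesis by (simp del: One_nat_def)
  qed
  have "(?l f q when k = Poly_Mapping.single i 1 + q) = (?l f q when q = m)" for q
    by (auto simp: k_def when_def add.commute)
  then have this_var: "(\<Sum>q. ?l f q when k = Poly_Mapping.single i 1 + q) = ?l f m"
    by (simp del: One_nat_def)
  have "?l (sym_of v * f) k
      = (\<Sum>j\<in>UNIV. v $ j * (\<Sum>q. ?l f q when k = Poly_Mapping.single j 1 + q))"
    by (simp add: sym_of_def sum_distrib_right lookup_sum lookup_single_mult)
  also have "\<dots> = v $ i * ?l f m"
    by (subst sum.remove[of UNIV i]) (simp_all add: this_var other del: One_nat_def)
  finally have "?l (sym_of v * f) k = v $ i * ?l f m" .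
  then show False using prod i m by (simp add: in_keys_iff)
qed

lemma linear_form_mult_cancel:
  fixes f g :: "'n::finite sym"
  assumes "sym_of v * f = sym_of v * g" "v \<noteq> 0"
  shows "f = g"
  using linear_form_mult_eq_0[of v "f - g"] assms by (simp add: right_diff_distrib)

lemma dvd_power_diff: "(c::'a::comm_ring_1) dvd a - b \<Longrightarrow> c dvd a ^ n - b ^ n"
  by (metis power_diff_sumr2 dvd_mult2)

lemma dvd_prod_diff:
  fixes c :: "'a::comm_ring_1"
  assumes "\<And>x. x \<in> A \<Longrightarrow> c dvd f x - g x"
  shows "c dvd prod f A - prod g A"
  using assms
proof (induction A rule: infinite_finite_induct)
  case (insert x A)
  have "prod f (insert x A) - prod g (insert x A)
      = (f x - g x) * prod f A + g x * (prod f A - prod g A)"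
    using insert by (simp add: algebra_simps)
  then show ?case using insert by (simp add: dvd_add)
qed simp_all

text \<open>
  Two algebra endomorphisms that agree on generators modulo \<open>\<alpha>\<close> agree modulo \<open>\<alpha>\<close>. The lemma serves
  twice: for reflections, and for projections with kernel spanned by \<open>\<alpha>\<close>.
\<close>

lemma sym_of_dvd_diff_sym_map:
  fixes p :: "'n::finite sym"
  assumes "\<And>v. \<exists>c. v - f v = c *s \<alpha>"
  shows "sym_of \<alpha> dvd p - sym_map f p"
proof -
  have gen: "sym_of \<alpha> dvd sym_of v - sym_of (f v)" for v
  proof -
    obtain c where "v - f v = c *s \<alpha>" using assms by blast
    then have "sym_of v - sym_of (f v) = Poly_Mapping.single 0 c * sym_of \<alpha>"
      by (metis sym_of_diff sym_of_scale)
    then show ?thesis by simp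
  qed
  have "sym_of \<alpha> dvd sym_map id p - sym_map f p"
    unfolding sym_map_def sum_subtractf[symmetric] right_diff_distrib[symmetric] id_def
    by (intro dvd_sum dvd_mult dvd_prod_diff dvd_power_diff gen)
  then show ?thesis by (simp add: sym_map_id)
qed

text \<open>
  Let \<open>\<pi>\<close> be a projection of the space of linear forms with kernel spanned by \<open>\<alpha>\<close>. The induced
  algebra map kills exactly the multiples of \<open>\<alpha>\<close>, while it sends \<open>\<beta>\<close> to a nonzero linear form,
  which is not a zero divisor.
\<close>

lemma linear_form_prime:
  fixes f :: "'n::finite sym"
  assumes dvd: "sym_of \<alpha> dvd sym_of \<beta> * f" and \<alpha>: "\<alpha> \<noteq> 0" and \<beta>: "\<And>c. \<beta> \<noteq> c *s \<alpha>"
  shows "sym_of \<alpha> dvd f"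
proof -
  obtain i where i: "\<alpha> $ i \<noteq> 0" using \<alpha> by (auto simp: vec_eq_iff)
  define \<pi> where "\<pi> v = v - (v $ i / \<alpha> $ i) *s \<alpha>" for v
  have linear: "Vector_Spaces.linear (*s) (*s) \<pi>"
    by unfold_locales (auto simp: \<pi>_def vec_eq_iff algebra_simps add_divide_distrib)
  have "\<pi> \<alpha> = 0" using i by (simp add: \<pi>_def)
  then have "sym_map \<pi> (sym_of \<alpha>) = 0"
    by (simp add: sym_map_sym_of[OF linear] sym_of_eq_0_iff)
  then have "sym_map \<pi> (sym_of \<beta> * f) = 0"
    using sym_map_dvd[OF dvd, of \<pi>] by simp
  then have "sym_of (\<pi> \<beta>) * sym_map \<pi> f = 0"
    by (simp add: sym_map_mult sym_map_sym_of[OF linear])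
  moreover have "\<pi> \<beta> \<noteq> 0" using \<beta> by (simp add: \<pi>_def)
  ultimately have "sym_map \<pi> f = 0" by (rule linear_form_mult_eq_0)
  moreover have "sym_of \<alpha> dvd f - sym_map \<pi> f"
    by (rule sym_of_dvd_diff_sym_map) (simp add: \<pi>_def)
  ultimately show ?thesis by simp
qed

lemma prod_linear_forms_dvd:
  fixes f :: "'n::finite sym"
  assumes "finite A" and "0 \<notin> A"
    and "\<And>\<alpha> \<beta> c. \<alpha> \<in> A \<Longrightarrow> \<beta> \<in> A \<Longrightarrow> \<alpha> = c *s \<beta> \<Longrightarrow> \<alpha> = \<beta>"
    and "\<And>\<alpha>. \<alpha> \<in> A \<Longrightarrow> sym_of \<alpha> dvd f"
  shows "(\<Prod>\<alpha>\<in>A. sym_of \<alpha>) dvd f"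
  using assms
proof (induction A arbitrary: f rule: finite_induct)
  case (insert \<beta> A)
  obtain g where g: "f = sym_of \<beta> * g" using insert.prems(3)[of \<beta>] by (auto simp: dvd_def)
  have "(\<Prod>\<alpha>\<in>A. sym_of \<alpha>) dvd g"
  proof (rule insert.IH)
    fix \<alpha> assume \<alpha>: "\<alpha> \<in> A"
    show "sym_of \<alpha> dvd g"
    proof (rule linear_form_prime)
      show "sym_of \<alpha> dvd sym_of \<beta> * g" using insert.prems(3)[of \<alpha>] \<alpha> g by simp
      show "\<alpha> \<noteq> 0" using insert.prems(1) \<alpha> by auto
      show "\<beta> \<noteq> c *s \<alpha>" for c
      proof
        assume "\<beta> = c *s \<alpha>"
        then have "\<beta> = \<alpha>" by (rule insert.prems(2)[rotated 2]) (use \<alpha> in auto)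
        then show False using \<alpha> insert.hyps by simp
      qed
    qed
  next
    show "0 \<notin> A" using insert.prems(1) by simp
    show "\<alpha> = \<beta>" if "\<alpha> \<in> A" "\<beta> \<in> A" "\<alpha> = c *s \<beta>" for \<alpha> \<beta> c
      using insert.prems(2)[of \<alpha> \<beta> c] that by blast
  qed
  then show ?case using insert.hyps g by (simp add: mult_dvd_mono)
qed simp


section \<open>Homogeneous elements\<close>

definition monomial_degree :: "('n::finite \<Rightarrow>\<^sub>0 nat) \<Rightarrow> nat" where
  "monomial_degree m = (\<Sum>i\<in>UNIV. Poly_Mapping.lookup m i)"

lemma monomial_degree_add: "monomial_degree (a + b) = monomial_degree a + monomial_degree b"
  by (simp add: monomial_degree_def lookup_add sum.distrib)

lemma homogeneous_iff: "homogeneous d p \<longleftrightarrow> (\<forall>m\<in>Poly_Mapping.keys p. monomial_degree m = d)"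
  by (simp add: homogeneous_def monomial_degree_def)

lemma homogeneous_diff: "homogeneous d p \<Longrightarrow> homogeneous d q \<Longrightarrow> homogeneous d (p - q)"
  using Poly_Mapping.keys_diff[of p q] by (auto simp: homogeneous_iff)

lemma homogeneous_sum: "(\<And>x. x \<in> A \<Longrightarrow> homogeneous d (f x)) \<Longrightarrow> homogeneous d (sum f A)"
  using Poly_Mapping.keys_sum[of f A] by (fastforce simp: homogeneous_iff)

lemma homogeneous_const: "homogeneous 0 (Poly_Mapping.single 0 c)"
  by (simp add: homogeneous_iff monomial_degree_def)

lemma homogeneous_mult: "homogeneous d p \<Longrightarrow> homogeneous e q \<Longrightarrow> homogeneous (d + e) (p * q)"
  using Poly_Mapping.keys_mult[of p q] by (fastforce simp: homogeneous_iff monomial_degree_add)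

lemma homogeneous_1: "homogeneous 0 1"
  using homogeneous_const[of 1] by simp

lemma homogeneous_prod:
  "(\<And>x. x \<in> A \<Longrightarrow> homogeneous (d x) (f x)) \<Longrightarrow> homogeneous (\<Sum>x\<in>A. d x) (\<Prod>x\<in>A. f x)"
  by (induction A rule: infinite_finite_induct) (simp_all add: homogeneous_1 homogeneous_mult)

lemma homogeneous_power: "homogeneous d f \<Longrightarrow> homogeneous (n * d) (f ^ n)"
  by (induction n) (simp_all add: homogeneous_1 homogeneous_mult)

lemma homogeneous_sym_of: "homogeneous 1 (sym_of v)"
  unfolding sym_of_def
  by (rule homogeneous_sum) (simp add: homogeneous_iff monomial_degree_def lookup_single when_def)

lemma homogeneous_sym_map:
  assumes "homogeneous d p"
  shows "homogeneous d (sym_map f p)"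
  unfolding sym_map_def
proof (rule homogeneous_sum)
  fix m assume "m \<in> Poly_Mapping.keys p"
  then have d: "d = 0 + (\<Sum>i\<in>UNIV. Poly_Mapping.lookup m i * 1)"
    using assms by (simp add: homogeneous_def)
  show "homogeneous d (Poly_Mapping.single 0 (Poly_Mapping.lookup p m) *
      (\<Prod>i\<in>UNIV. sym_of (f (axis i 1)) ^ Poly_Mapping.lookup m i))"
    unfolding d
    by (intro homogeneous_mult homogeneous_const homogeneous_prod homogeneous_power homogeneous_sym_of)
qed

lemma homogeneous_unique: "homogeneous d p \<Longrightarrow> homogeneous e p \<Longrightarrow> p \<noteq> 0 \<Longrightarrow> d = e"
  unfolding homogeneous_iff using keys_eq_empty[of p] by fastforce

text \<open>
  The cofactor may be inhomogeneous, so the bound comes from a single monomial of \<open>f\<close>, which splits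
  off a monomial of \<open>g\<close>.
\<close>

lemma homogeneous_dvd_degree:
  assumes "homogeneous d f" "homogeneous e g" "g dvd f" "f \<noteq> 0"
  shows "e \<le> d"
proof -
  obtain h where h: "f = g * h" using assms(3) by (auto simp: dvd_def)
  obtain m where "m \<in> Poly_Mapping.keys f" using assms(4) keys_eq_empty[of f] by fastforce
  moreover from this obtain a b where "m = a + b" "a \<in> Poly_Mapping.keys g"
    using Poly_Mapping.keys_mult[of g h] by (auto simp: h)
  ultimately show ?thesis
    using assms(1,2) by (auto simp: homogeneous_iff monomial_degree_add)
qed

section \<open>Groups generated by involutions\<close>

lemma generated_comp:
  assumes "u \<in> generated S" "v \<in> generated S"
  shows "u \<circ> v \<in> generated S"
  using assms by induction (auto simp: comp_assoc intro: generated.intros)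

lemma generator_in_generated: "s \<in> S \<Longrightarrow> s \<in> generated S"
  using generated.intros(2)[OF _ generated.intros(1)] by simp

lemma generated_subset:
  assumes "S \<subseteq> generated S'"
  shows "generated S \<subseteq> generated S'"
proof
  fix w assume "w \<in> generated S"
  then show "w \<in> generated S'"
  proof induction
    case (2 s w)
    then show ?case using assms by (blast intro: generated_comp)
  qed (rule generated.intros)
qed

lemma generated_bij_inv:
  assumes "\<And>s. s \<in> S \<Longrightarrow> s \<circ> s = id" and "w \<in> generated S"
  shows "bij w \<and> inv w \<in> generated S"
  using assms(2)
proof induction
  case 1
  show ?case unfolding inv_id using bij_id generated.intros(1) by (rule conjI)
next
  case (2 s w)
  have s: "bij s" "inv s = s"
    using assms(1)[OF 2(1)] by (auto intro: o_bij inv_unique_comp)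
  have "inv (s \<circ> w) = inv w \<circ> s"
    using 2 s by (simp add: o_inv_distrib)
  moreover have "inv w \<circ> s \<in> generated S"
    using 2 by (blast intro: generated_comp generator_in_generated)
  moreover have "bij (s \<circ> w)"
    using 2 s by (blast intro: bij_comp)
  ultimately show ?case by metis
qed

section \<open>Roots and simple reflections\<close>

locale based_roots =
  fixes D :: "'n::finite root_data"
  assumes based: "based_root_system D"
begin

abbreviation "pairing x \<alpha> \<equiv> scalar_product x (coroot D \<alpha>)"
abbreviation "reflection \<equiv> refl_root D"
abbreviation "\<Phi> \<equiv> roots D"
abbreviation "pos \<equiv> positive_roots D"
abbreviation "\<alpha> \<equiv> simple D"
abbreviation "s \<equiv> simple_refl D"
abbreviation "W \<equiv> weyl D"
abbreviation "len \<equiv> weyl_length D"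

lemma
  shows finite_roots: "finite \<Phi>"
    and zero_not_root: "0 \<notin> \<Phi>"
    and span_roots: "vec.span \<Phi> = UNIV"
    and pairing_self: "\<beta> \<in> \<Phi> \<Longrightarrow> pairing \<beta> \<beta> = 2"
    and refl_roots: "\<beta> \<in> \<Phi> \<Longrightarrow> reflection \<beta> ` \<Phi> = \<Phi>"
    and pairing_Ints: "\<beta> \<in> \<Phi> \<Longrightarrow> \<gamma> \<in> \<Phi> \<Longrightarrow> pairing \<gamma> \<beta> \<in> \<int>"
    and reduced: "\<beta> \<in> \<Phi> \<Longrightarrow> c *s \<beta> \<in> \<Phi> \<Longrightarrow> c = 1 \<or> c = -1"
    and inj_simple: "inj \<alpha>"
    and simple_root: "\<alpha> i \<in> \<Phi>"
    and independent_simple: "vec.independent (range \<alpha>)"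
    and pos_or_neg: "\<beta> \<in> \<Phi> \<Longrightarrow> \<beta> \<in> pos \<or> - \<beta> \<in> pos"
  using based
  unfolding based_root_system_def root_system_def is_base_def by blast+

lemma pairing_linear:
  "pairing (x + y) \<beta> = pairing x \<beta> + pairing y \<beta>"
  "pairing (x - y) \<beta> = pairing x \<beta> - pairing y \<beta>"
  "pairing (c *s x) \<beta> = c * pairing x \<beta>"
  "pairing (- x) \<beta> = - pairing x \<beta>"
  by (simp_all add: scalar_product_def algebra_simps sum.distrib sum_subtractf sum_distrib_left sum_negf)

lemma linear_refl: "Vector_Spaces.linear (*s) (*s) (reflection \<beta>)"
  by unfold_locales
     (simp_all add: refl_root_def pairing_linear vec_eq_iff algebra_simps)

lemma refl_self: "\<beta> \<in> \<Phi> \<Longrightarrow> reflection \<beta> \<beta> = - \<beta>"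
  by (simp add: refl_root_def pairing_self vec_eq_iff)

lemma refl_refl: "\<beta> \<in> \<Phi> \<Longrightarrow> reflection \<beta> (reflection \<beta> x) = x"
  by (simp add: refl_root_def pairing_self pairing_linear vec_eq_iff algebra_simps)

lemma refl_invol: "\<beta> \<in> \<Phi> \<Longrightarrow> reflection \<beta> \<circ> reflection \<beta> = id"
  by (auto simp: refl_refl)

lemma refl_in_roots: "\<beta> \<in> \<Phi> \<Longrightarrow> \<gamma> \<in> \<Phi> \<Longrightarrow> reflection \<beta> \<gamma> \<in> \<Phi>"
  using refl_roots by blast

lemma pos_root: "\<beta> \<in> pos \<Longrightarrow> \<beta> \<in> \<Phi>"
  by (simp add: positive_roots_def)

lemma finite_pos: "finite pos"
  by (rule finite_subset[OF _ finite_roots]) (auto dest: pos_root)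

lemma simple_combination_unique:
  assumes "(\<Sum>i\<in>UNIV. a i *s \<alpha> i) = (\<Sum>i\<in>UNIV. b i *s \<alpha> i)"
  shows "a i = b i"
proof -
  let ?u = "\<lambda>v. a (inv \<alpha> v) - b (inv \<alpha> v)"
  have "(\<Sum>v\<in>range \<alpha>. ?u v *s v) = (\<Sum>i\<in>UNIV. (a i - b i) *s \<alpha> i)"
    by (simp add: sum.reindex[OF inj_simple] inj_simple)
  also have "\<dots> = 0"
    using assms by (simp add: vec.scale_left_diff_distrib sum_subtractf)
  finally have "?u (\<alpha> i) = 0"
    by (intro vec.independentD[OF independent_simple, of "range \<alpha>"]) auto
  then show ?thesis by (simp add: inj_simple)
qed

lemma pos_not_neg:
  assumes "\<beta> \<in> pos"
  shows "- \<beta> \<notin> pos"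
proof
  assume "- \<beta> \<in> pos"
  with assms obtain c d :: "'n \<Rightarrow> nat"
    where c: "\<beta> = (\<Sum>i\<in>UNIV. of_nat (c i) *s \<alpha> i)"
      and d: "- \<beta> = (\<Sum>i\<in>UNIV. of_nat (d i) *s \<alpha> i)"
    by (auto simp: positive_roots_def)
  have "(\<Sum>i\<in>UNIV. of_nat (c i) *s \<alpha> i) = (\<Sum>i\<in>UNIV. (- of_nat (d i)) *s \<alpha> i)"
    using c d by (simp add: sum_negf) (metis add.inverse_inverse)
  then have "of_nat (c i) = (- of_nat (d i) :: complex)" for i
    by (rule simple_combination_unique)
  then have "of_nat (c i + d i) = (0::complex)" for i by simp
  then have "c i = 0" for i by (metis add_is_0 of_nat_eq_0_iff)
  then have "\<beta> = 0" using c by simp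
  then show False using assms pos_root zero_not_root by blast
qed

lemma neg_iff_not_pos: "\<beta> \<in> \<Phi> \<Longrightarrow> - \<beta> \<in> pos \<longleftrightarrow> \<beta> \<notin> pos"
  using pos_or_neg pos_not_neg by blast

lemma simple_pos: "\<alpha> i \<in> pos"
  unfolding positive_roots_def using simple_root[of i]
  by (auto simp: intro!: exI[of _ "\<lambda>j. if j = i then 1 else 0"])
     (simp add: if_distrib[of "\<lambda>n. of_nat n *s _"] cong: if_cong)

text \<open>
  A simple reflection changes only the \<open>i\<close>-th coefficient. As \<open>\<beta>\<close> is not a multiple of \<open>\<alpha> i\<close>, it
  has a positive coefficient elsewhere, which its image keeps; and the coefficients of a root
  have a common sign.
\<close>

lemma simple_refl_pos:
  assumes \<beta>: "\<beta> \<in> pos" and ne: "\<beta> \<noteq> \<alpha> i"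
  shows "s i \<beta> \<in> pos"
proof (rule ccontr)
  assume "s i \<beta> \<notin> pos"
  then have "- s i \<beta> \<in> pos"
    using \<beta> neg_iff_not_pos pos_root refl_in_roots simple_root by blast
  with \<beta> obtain c d :: "'n \<Rightarrow> nat"
    where c: "\<beta> = (\<Sum>j\<in>UNIV. of_nat (c j) *s \<alpha> j)"
      and d: "- s i \<beta> = (\<Sum>j\<in>UNIV. of_nat (d j) *s \<alpha> j)"
    by (auto simp: positive_roots_def)
  let ?m = "pairing \<beta> (\<alpha> i)"
  have m: "(\<Sum>j\<in>UNIV. (if j = i then ?m else 0) *s \<alpha> j) = ?m *s \<alpha> i"
    by (simp add: if_distrib[of "\<lambda>n. n *s _"] cong: if_cong)
  have "(\<Sum>j\<in>UNIV. of_nat (c j) *s \<alpha> j)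
      = (\<Sum>j\<in>UNIV. ((if j = i then ?m else 0) - of_nat (d j)) *s \<alpha> j)"
    unfolding vec.scale_left_diff_distrib sum_subtractf m c[symmetric] d[symmetric]
    by (simp add: refl_root_def)
  then have cd: "of_nat (c j) = (if j = i then ?m else 0) - of_nat (d j)" for j
    by (rule simple_combination_unique)
  \<comment> \<open>a nonnegative coefficient that equals a nonpositive one is zero\<close>
  have c0: "c j = 0" if "j \<noteq> i" for j
  proof -
    have "of_nat (c j + d j) = (0::complex)" using cd[of j] that by simp
    then show ?thesis by (metis add_is_0 of_nat_eq_0_iff)
  qed
  have "\<beta> = of_nat (c i) *s \<alpha> i"
    unfolding c by (subst sum.remove[of _ i]) (auto simp: c0)
  then have "of_nat (c i) = (1::complex) \<or> of_nat (c i) = (-1::complex)"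
    using reduced[OF simple_root[of i]] \<beta> pos_root by metis
  moreover have "of_nat (c i) \<noteq> (-1::complex)"
    by (metis of_nat_Suc of_nat_0_neq add.commute add.right_inverse)
  ultimately have "\<beta> = \<alpha> i"
    using \<open>\<beta> = of_nat (c i) *s \<alpha> i\<close> by simp
  with ne show False ..
qed

section \<open>The Weyl group\<close>

lemma id_weyl: "id \<in> W"
  unfolding weyl_def by (rule generated.intros)

lemma refl_weyl: "\<beta> \<in> \<Phi> \<Longrightarrow> reflection \<beta> \<in> W"
  unfolding weyl_def by (simp add: generator_in_generated)

lemma comp_weyl: "u \<in> W \<Longrightarrow> v \<in> W \<Longrightarrow> u \<circ> v \<in> W"
  unfolding weyl_def by (rule generated_comp)

lemma weyl_bij: "w \<in> W \<Longrightarrow> bij w" and inv_weyl: "w \<in> W \<Longrightarrow> inv w \<in> W"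
  using generated_bij_inv[of "reflection ` \<Phi>" w] refl_invol by (auto simp: weyl_def)

lemma weyl_linear: "w \<in> W \<Longrightarrow> Vector_Spaces.linear (*s) (*s) w"
  unfolding weyl_def
proof (induction rule: generated.induct)
  case 1 show ?case by (rule vec.linear_id)
next
  case (2 t w)
  then show ?case using linear_refl Vector_Spaces.linear_compose by blast
qed

lemma weyl_roots: "w \<in> W \<Longrightarrow> \<beta> \<in> \<Phi> \<Longrightarrow> w \<beta> \<in> \<Phi>"
  unfolding weyl_def
  by (induction rule: generated.induct) (auto intro: refl_in_roots)

lemma weyl_uminus: "w \<in> W \<Longrightarrow> w (- x) = - w x"
  using weyl_linear[of w] by (metis vec.linear_neg)

lemma inv_weyl_apply: "w \<in> W \<Longrightarrow> w (inv w x) = x" "w \<in> W \<Longrightarrow> inv w (w x) = x"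
  using weyl_bij[of w] by (simp_all add: bij_is_surj surj_f_inv_f bij_is_inj)

lemma inv_comp_apply: "u \<in> W \<Longrightarrow> v \<in> W \<Longrightarrow> inv (u \<circ> v) x = inv v (inv u x)"
  by (simp add: o_inv_distrib weyl_bij)

lemma inv_refl: "\<beta> \<in> \<Phi> \<Longrightarrow> inv (reflection \<beta>) = reflection \<beta>"
  by (rule inv_unique_comp) (rule refl_invol, assumption)+

text \<open>
  An element of the Weyl group is determined by the permutation of the roots that it induces, since
  the roots span the space.
\<close>

lemma finite_weyl: "finite W"
proof (rule inj_on_finite)
  show "(\<lambda>w. restrict w \<Phi>) ` W \<subseteq> \<Phi> \<rightarrow>\<^sub>E \<Phi>" using weyl_roots by auto
  show "finite (\<Phi> \<rightarrow>\<^sub>E \<Phi>)" by (intro finite_PiE finite_roots)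
  show "inj_on (\<lambda>w. restrict w \<Phi>) W"
  proof (rule inj_onI)
    fix u v assume uv: "u \<in> W" "v \<in> W" and eq: "restrict u \<Phi> = restrict v \<Phi>"
    show "u = v"
    proof
      fix x
      show "u x = v x"
      proof (rule vec.linear_eq_on_span[OF weyl_linear[OF uv(1)] weyl_linear[OF uv(2)]])
        show "u b = v b" if "b \<in> \<Phi>" for b using fun_cong[OF eq, of b] that by simp
        show "x \<in> vec.span \<Phi>" by (simp add: span_roots)
      qed
    qed
  qed
qed


section \<open>Generation by simple reflections\<close>

text \<open>
  Averaging the real inner product of \<open>complex ^ 'n\<close> over the group makes it invariant. Real values
  suffice, as the coefficients of roots and the Cartan integers are real.
\<close>

definition form :: "complex ^ 'n \<Rightarrow> complex ^ 'n \<Rightarrow> real" where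
  "form x y = (\<Sum>w\<in>W. w x \<bullet> w y)"

lemma weyl_diff: "w \<in> W \<Longrightarrow> w (x - y) = w x - w y"
  using weyl_linear[of w] by (metis vec.linear_diff)

lemma weyl_add: "w \<in> W \<Longrightarrow> w (x + y) = w x + w y"
  using weyl_linear[of w] by (metis vec.linear_add)

lemma of_real_scale: "complex_of_real c *s x = c *\<^sub>R x"
  by (simp add: vec_eq_iff) (simp add: scaleR_conv_of_real)

lemma weyl_scaleR: "w \<in> W \<Longrightarrow> w (c *\<^sub>R x) = c *\<^sub>R w x"
  using weyl_linear[of w] by (metis vec.linear_scale of_real_scale)

lemma form_linear:
  "form (x + y) z = form x z + form y z"
  "form (x - y) z = form x z - form y z"
  "form (c *\<^sub>R x) z = c * form x z"
  "form (- x) z = - form x z"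
  by (simp_all add: form_def weyl_add weyl_diff weyl_scaleR weyl_uminus inner_left_distrib
      inner_diff_left sum.distrib sum_subtractf sum_distrib_left sum_negf)

lemma form_sum: "form (\<Sum>i\<in>A. f i) z = (\<Sum>i\<in>A. form (f i) z)"
proof (induction A rule: infinite_finite_induct)
  have "form 0 z = 0" using form_linear(2)[of 0 0 z] by simp
  then show "form (\<Sum>i\<in>{}. f i) z = (\<Sum>i\<in>{}. form (f i) z)"
    and "infinite A \<Longrightarrow> form (\<Sum>i\<in>A. f i) z = (\<Sum>i\<in>A. form (f i) z)" for A
    by simp_all
qed (simp add: form_linear)

lemma form_commute: "form x y = form y x"
  by (simp add: form_def inner_commute)

lemma form_pos:
  assumes "x \<noteq> 0" shows "form x x > 0"
proof -
  have "0 < id x \<bullet> id x" using assms by simp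
  also have "\<dots> \<le> form x x"
    unfolding form_def by (rule member_le_sum[OF id_weyl]) (auto simp: finite_weyl)
  finally show ?thesis .
qed

lemma form_invariant:
  assumes "u \<in> W" shows "form (u x) (u y) = form x y"
proof -
  have "bij_betw (\<lambda>w. w \<circ> u) W W"
  proof (rule bij_betw_byWitness[where f' = "\<lambda>w. w \<circ> inv u"])
    show "\<forall>w\<in>W. w \<circ> u \<circ> inv u = w" "\<forall>w\<in>W. w \<circ> inv u \<circ> u = w"
      using assms by (auto simp: inv_weyl_apply)
  qed (use assms comp_weyl inv_weyl in auto)
  then show ?thesis
    unfolding form_def using sum.reindex_bij_betw[of "\<lambda>w. w \<circ> u" W W "\<lambda>w. w x \<bullet> w y"] by simp
qed

lemma pairing_form:
  assumes "\<beta> \<in> \<Phi>" "\<gamma> \<in> \<Phi>" and m: "pairing \<gamma> \<beta> = of_int m"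
  shows "2 * form \<gamma> \<beta> = m * form \<beta> \<beta>"
proof -
  have "reflection \<beta> \<gamma> = \<gamma> - of_int m *\<^sub>R \<beta>"
    using m of_real_scale[of "of_int m" \<beta>] by (simp add: refl_root_def)
  then have "form \<gamma> \<beta> = form (\<gamma> - of_int m *\<^sub>R \<beta>) (- \<beta>)"
    using form_invariant[OF refl_weyl[OF assms(1)], of \<gamma> \<beta>] by (simp add: refl_self assms(1))
  also have "\<dots> = - (form \<gamma> \<beta> - m * form \<beta> \<beta>)"
  proof -
    have "form x (- \<beta>) = - form x \<beta>" for x by (metis form_commute form_linear(4))
    then show ?thesis by (simp add: form_linear)
  qed
  finally show ?thesis by simp
qed

text \<open>
  On roots the pairing is expressed by the invariant form, by \<open>pairing_form\<close>; both sides are linear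
  in \<open>x\<close>, and the roots span. Thus the coroots are permuted along with the roots, although they are
  only given as a function on the roots.
\<close>

lemma pairing_invariant:
  assumes g: "g \<in> W" and \<beta>: "\<beta> \<in> \<Phi>"
  shows "pairing (g x) (g \<beta>) = pairing x \<beta>"
proof -
  have "x \<in> vec.span \<Phi>" by (simp add: span_roots)
  then show ?thesis
  proof (induction rule: vec.span_induct_alt)
    case base
    show ?case using weyl_diff[OF g, of 0 0] by (simp add: scalar_product_def)
  next
    case (step c \<gamma> y)
    obtain m where m: "pairing \<gamma> \<beta> = of_int m"
      using pairing_Ints[OF \<beta> step(1)] by (auto elim: Ints_cases)
    obtain m' where m': "pairing (g \<gamma>) (g \<beta>) = of_int m'"
      using pairing_Ints[of "g \<beta>" "g \<gamma>"] weyl_roots[OF g] \<beta> step(1) by (auto elim: Ints_cases)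
    have "of_int m * form \<beta> \<beta> = of_int m' * form \<beta> \<beta>"
      using pairing_form[OF \<beta> step(1) m] pairing_form[OF _ _ m'] weyl_roots[OF g] \<beta> step(1)
      by (simp add: form_invariant[OF g])
    moreover have "form \<beta> \<beta> > 0" using \<beta> zero_not_root by (intro form_pos) auto
    ultimately have "m = m'" by simp
    moreover have "g (c *s \<gamma> + y) = c *s g \<gamma> + g y"
      using weyl_linear[OF g] by (simp add: weyl_add[OF g] vec.linear_scale)
    ultimately show ?case using step m m' by (simp add: pairing_linear)
  qed
qed

lemma refl_conj:
  assumes g: "g \<in> W" and \<beta>: "\<beta> \<in> \<Phi>"
  shows "reflection (g \<beta>) \<circ> g = g \<circ> reflection \<beta>"
proof
  fix x
  show "(reflection (g \<beta>) \<circ> g) x = (g \<circ> reflection \<beta>) x"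
    using weyl_linear[OF g]
    by (simp add: refl_root_def pairing_invariant[OF g \<beta>] weyl_diff[OF g] vec.linear_scale)
qed

lemma refl_uminus: "\<beta> \<in> \<Phi> \<Longrightarrow> reflection (- \<beta>) = reflection \<beta>"
  using refl_conj[OF refl_weyl, of \<beta> \<beta>] fun_cong[OF refl_conj[OF refl_weyl, of \<beta> \<beta>]]
  by (metis comp_def ext refl_refl refl_self)

text \<open>
  The inner product of a root with itself is positive, so the root has a positive inner product with
  a simple root that occurs in it.
\<close>

lemma pos_pairing_pos:
  assumes "\<beta> \<in> pos"
  obtains i m where "pairing \<beta> (\<alpha> i) = of_int m" "m > 0"
proof -
  obtain c :: "'n \<Rightarrow> nat" where c: "\<beta> = (\<Sum>i\<in>UNIV. of_nat (c i) *s \<alpha> i)"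
    using assms by (auto simp: positive_roots_def)
  have "\<beta> = (\<Sum>i\<in>UNIV. real (c i) *\<^sub>R \<alpha> i)"
    unfolding of_real_scale[symmetric] using c by simp
  from arg_cong[OF this, of "\<lambda>x. form x \<beta>"]
  have "form \<beta> \<beta> = (\<Sum>i\<in>UNIV. real (c i) * form (\<alpha> i) \<beta>)"
    by (simp only: form_sum form_linear(3))
  moreover have "form \<beta> \<beta> > 0"
    using assms pos_root zero_not_root by (intro form_pos) auto
  ultimately have "\<not> (\<forall>i\<in>UNIV. real (c i) * form (\<alpha> i) \<beta> \<le> 0)"
    using sum_nonpos[of UNIV "\<lambda>i. real (c i) * form (\<alpha> i) \<beta>"] by fastforce
  then obtain i where "real (c i) * form (\<alpha> i) \<beta> > 0" by (auto simp: not_le)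
  then have i: "form \<beta> (\<alpha> i) > 0" by (simp add: form_commute zero_less_mult_iff)
  obtain m where m: "pairing \<beta> (\<alpha> i) = of_int m"
    using pairing_Ints[OF simple_root pos_root[OF assms]] by (auto elim: Ints_cases)
  have "of_int m * form (\<alpha> i) (\<alpha> i) > 0"
    using pairing_form[OF simple_root pos_root[OF assms] m] i by simp
  moreover have "form (\<alpha> i) (\<alpha> i) > 0"
    by (rule form_pos) (metis simple_root zero_not_root)
  ultimately have "m > 0" by (simp add: zero_less_mult_iff)
  with m show ?thesis by (rule that)
qed

text \<open>
  Induction on the height of the root: a simple reflection that pairs positively with it lowers
  its height, and conjugation by this reflection relates the two root reflections.
\<close>

lemma refl_generated_simple:
  assumes "(\<Sum>i\<in>UNIV. of_nat (c i) *s \<alpha> i) \<in> \<Phi>"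
  shows "reflection (\<Sum>i\<in>UNIV. of_nat (c i) *s \<alpha> i) \<in> generated (range s)"
  using assms
proof (induction "\<Sum>i\<in>UNIV. c i" arbitrary: c rule: less_induct)
  case less
  let ?\<beta> = "\<Sum>i\<in>UNIV. of_nat (c i) *s \<alpha> i"
  have \<beta>: "?\<beta> \<in> pos" using less.prems by (auto simp: positive_roots_def)
  show ?case
  proof (cases "\<exists>i. ?\<beta> = \<alpha> i")
    case True
    then show ?thesis by (auto intro: generator_in_generated)
  next
    case False
    obtain i m where m: "pairing ?\<beta> (\<alpha> i) = of_int m" "m > 0"
      using pos_pairing_pos[OF \<beta>] by blast
    have "s i ?\<beta> \<in> pos" using simple_refl_pos[OF \<beta>] False by blast
    then obtain d :: "'n \<Rightarrow> nat" where d: "s i ?\<beta> = (\<Sum>j\<in>UNIV. of_nat (d j) *s \<alpha> j)"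
      by (auto simp: positive_roots_def)
    have "(\<Sum>j\<in>UNIV. (if j = i then of_int m else 0) *s \<alpha> j) = of_int m *s \<alpha> i"
      by (simp add: if_distrib[of "\<lambda>n. n *s _"] cong: if_cong)
    then have "(\<Sum>j\<in>UNIV. of_nat (d j) *s \<alpha> j)
        = (\<Sum>j\<in>UNIV. (of_nat (c j) - (if j = i then of_int m else 0)) *s \<alpha> j)"
      unfolding vec.scale_left_diff_distrib sum_subtractf d[symmetric]
      by (simp add: refl_root_def m)
    then have dc: "of_nat (d j) = (of_nat (c j) - (if j = i then of_int m else 0) :: complex)" for j
      by (rule simple_combination_unique)
    have "of_int (int (d j)) = (of_int (int (c j) - (if j = i then m else 0)) :: complex)" for j
      using dc[of j] by simp
    then have dc: "int (d j) = int (c j) - (if j = i then m else 0)" for j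
      using of_int_eq_iff by blast
    have "(\<Sum>j\<in>UNIV. d j) < (\<Sum>j\<in>UNIV. c j)"
    proof (rule sum_strict_mono_ex1)
      show "\<forall>j\<in>UNIV. d j \<le> c j"
      proof
        fix j show "d j \<le> c j" using dc[of j] m(2) by (auto split: if_splits)
      qed
      show "\<exists>j\<in>UNIV. d j < c j" using dc[of i] m(2) by (intro bexI[of _ i]) auto
    qed simp
    moreover have "(\<Sum>j\<in>UNIV. of_nat (d j) *s \<alpha> j) \<in> \<Phi>"
      using refl_in_roots[OF simple_root less.prems, of i] unfolding d .
    ultimately have "reflection (s i ?\<beta>) \<in> generated (range s)"
      using less.hyps d by simp
    then have "s i \<circ> (reflection (s i ?\<beta>) \<circ> s i) \<in> generated (range s)"
      by (blast intro: generated_comp generator_in_generated)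
    moreover have "s i \<circ> (reflection (s i ?\<beta>) \<circ> s i) = reflection ?\<beta>"
      unfolding refl_conj[OF refl_weyl[OF simple_root] less.prems]
      unfolding comp_assoc[symmetric] refl_invol[OF simple_root] by (rule id_comp)
    ultimately show ?thesis by simp
  qed
qed

lemma weyl_eq_generated_simple: "W = generated (range s)"
proof
  have "reflection \<beta> \<in> generated (range s)" if "\<beta> \<in> \<Phi>" for \<beta>
  proof -
    have "reflection \<gamma> \<in> generated (range s)" if "\<gamma> \<in> pos" for \<gamma>
      using refl_generated_simple that by (auto simp: positive_roots_def)
    then show ?thesis using pos_or_neg[OF that] refl_uminus[OF that] by metis
  qed
  then show "W \<subseteq> generated (range s)"
    unfolding weyl_def by (intro generated_subset) auto
  show "generated (range s) \<subseteq> W"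
    unfolding weyl_def using simple_root
    by (intro generated_subset) (auto intro!: generator_in_generated)
qed


lemma refl_comp_cancel: "\<beta> \<in> \<Phi> \<Longrightarrow> reflection \<beta> \<circ> (reflection \<beta> \<circ> w) = w"
  by (simp add: fun_eq_iff refl_refl)

lemma simple_comp_cancel: "s i \<circ> (s i \<circ> w) = w"
  by (rule refl_comp_cancel[OF simple_root])

lemma weyl_comp_cancel:
  "w \<in> W \<Longrightarrow> inv w \<circ> (w \<circ> x) = x" "w \<in> W \<Longrightarrow> w \<circ> (inv w \<circ> x) = x"
  by (simp_all add: fun_eq_iff inv_weyl_apply)

section \<open>Reduced words and the exchange property\<close>

definition word :: "'n list \<Rightarrow> complex ^ 'n \<Rightarrow> complex ^ 'n" where
  "word is = foldr (\<lambda>i v. s i \<circ> v) is id"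

lemma word_simps [simp]: "word [] = id" "word (i # is) = s i \<circ> word is"
  by (simp_all add: word_def)

lemma weyl_word: "w \<in> W \<Longrightarrow> \<exists>is. w = word is"
  unfolding weyl_eq_generated_simple
proof (induction rule: generated.induct)
  case 1
  show ?case by (rule exI[of _ "[]"]) simp
next
  case (2 t w)
  then show ?case by (metis rangeE word_simps(2))
qed

lemma simple_refl_weyl: "s i \<in> W"
  by (rule refl_weyl[OF simple_root])

lemma word_weyl: "word is \<in> W"
  by (induction "is") (simp_all only: word_simps id_weyl comp_weyl simple_refl_weyl)

lemma len_word_le: "len (word is) \<le> length is"
  unfolding weyl_length_def word_def by (rule Least_le) blast

lemma reduced_word:
  assumes "w \<in> W"
  obtains "is" where "w = word is" "length is = len w"
proof -
  obtain js where "w = word js" using weyl_word[OF assms] by blast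
  then have "\<exists>is. length is = length js \<and> w = foldr (\<lambda>i v. s i \<circ> v) is id"
    by (auto simp: word_def)
  then have "\<exists>is. length is = len w \<and> w = foldr (\<lambda>i v. s i \<circ> v) is id"
    unfolding weyl_length_def by (rule LeastI)
  then show ?thesis using that by (auto simp: word_def)
qed

lemma len_simple_le: "w \<in> W \<Longrightarrow> len (s i \<circ> w) \<le> Suc (len w)"
  by (metis len_word_le length_Cons reduced_word word_simps(2))

text \<open>
  Reading the word from the left, the root stays positive until it becomes the simple root of the
  current letter; deleting this letter amounts to multiplication by the reflection.
\<close>

lemma exchange:
  assumes "\<beta> \<in> pos" "- inv (word is) \<beta> \<in> pos"
  shows "\<exists>js. length is = Suc (length js) \<and> reflection \<beta> \<circ> word is = word js"
  using assms
proof (induction "is" arbitrary: \<beta>)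
  case Nil
  then show ?case using pos_not_neg by simp
next
  case (Cons i "is")
  show ?case
  proof (cases "\<beta> = \<alpha> i")
    case True
    then have "reflection \<beta> \<circ> word (i # is) = word is"
      by (simp only: word_simps simple_comp_cancel)
    then show ?thesis by (intro exI[of _ "is"] conjI) simp
  next
    case False
    have "inv (word (i # is)) \<beta> = inv (word is) (s i \<beta>)"
      by (simp only: word_simps inv_comp_apply[OF simple_refl_weyl word_weyl] inv_refl[OF simple_root])
    then have "- inv (word is) (s i \<beta>) \<in> pos" using Cons.prems(2) by (simp only:)
    from Cons.IH[OF simple_refl_pos[OF Cons.prems(1) False] this]
    obtain js where js: "length is = Suc (length js)" "reflection (s i \<beta>) \<circ> word is = word js"
      by (elim exE conjE)
    have "s i \<circ> reflection (s i \<beta>) = reflection \<beta> \<circ> s i"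
      using refl_conj[OF simple_refl_weyl, of "s i \<beta>" i] refl_in_roots[OF simple_root] Cons.prems(1) pos_root
      by (simp add: refl_refl simple_root)
    then have "reflection \<beta> \<circ> word (i # is) = word (i # js)"
      by (simp only: word_simps js(2)[symmetric] comp_assoc[symmetric])
    moreover have "length (i # is) = Suc (length (i # js))" using js(1) by simp
    ultimately show ?thesis by blast
  qed
qed

lemma len_refl_less:
  assumes "w \<in> W" "\<beta> \<in> pos" "- inv w \<beta> \<in> pos"
  shows "len (reflection \<beta> \<circ> w) < len w"
proof -
  obtain "is" where "is": "w = word is" "length is = len w" by (rule reduced_word[OF assms(1)])
  then obtain js where "length is = Suc (length js)" "reflection \<beta> \<circ> w = word js"
    using exchange assms by blast
  then show ?thesis using "is"(2) len_word_le[of js] by simp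
qed


section \<open>Parabolic cosets\<close>

lemma parabolic_subset: "weyl_parabolic D J \<subseteq> W"
  unfolding weyl_parabolic_def weyl_def using simple_root
  by (intro generated_subset) (auto intro!: generator_in_generated)

lemma parabolic_inv: "u \<in> weyl_parabolic D J \<Longrightarrow> inv u \<in> weyl_parabolic D J"
  using generated_bij_inv[of "s ` J" u] refl_invol simple_root
  by (auto simp: weyl_parabolic_def)

lemma parabolic_comp:
  "u \<in> weyl_parabolic D J \<Longrightarrow> v \<in> weyl_parabolic D J \<Longrightarrow> u \<circ> v \<in> weyl_parabolic D J"
  unfolding weyl_parabolic_def by (rule generated_comp)

lemma coset_self: "w \<in> coset D J w"
  unfolding coset_def weyl_parabolic_def
  by (rule image_eqI[of _ _ id]) (simp_all add: generated.intros)

lemma coset_eq_iff: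
  assumes "w \<in> W"
  shows "coset D J v = coset D J w \<longleftrightarrow> (\<exists>u\<in>weyl_parabolic D J. v = w \<circ> u)"
proof
  assume "coset D J v = coset D J w"
  then have "v \<in> coset D J w" using coset_self by metis
  then show "\<exists>u\<in>weyl_parabolic D J. v = w \<circ> u" by (auto simp: coset_def)
next
  assume "\<exists>u\<in>weyl_parabolic D J. v = w \<circ> u"
  then obtain u where u: "u \<in> weyl_parabolic D J" "v = w \<circ> u" by blast
  have "(\<lambda>x. u \<circ> x) ` weyl_parabolic D J = weyl_parabolic D J"
  proof
    show "weyl_parabolic D J \<subseteq> (\<lambda>x. u \<circ> x) ` weyl_parabolic D J"
    proof
      fix x assume x: "x \<in> weyl_parabolic D J"
      have "x = u \<circ> (inv u \<circ> x)" by (rule weyl_comp_cancel(2)[symmetric]) (use u(1) parabolic_subset in blast)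
      then show "x \<in> (\<lambda>x. u \<circ> x) ` weyl_parabolic D J"
        using parabolic_comp[OF parabolic_inv[OF u(1)] x] by (rule image_eqI)
    qed
  qed (use parabolic_comp[OF u(1)] in blast)
  then show "coset D J v = coset D J w"
    unfolding coset_def u(2) comp_assoc
    using image_image[of "\<lambda>x. w \<circ> x" "\<lambda>x. u \<circ> x" "weyl_parabolic D J"] by metis
qed

lemma in_coset:
  assumes "w \<in> W" "v \<in> coset D J w"
  shows "v \<in> W" "coset D J v = coset D J w"
proof -
  obtain u where u: "u \<in> weyl_parabolic D J" "v = w \<circ> u" using assms(2) by (auto simp: coset_def)
  then show "v \<in> W" using comp_weyl assms(1) parabolic_subset by blast
  show "coset D J v = coset D J w" using u coset_eq_iff[OF assms(1)] by blast
qed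

lemma coset_image: "(\<lambda>x. v \<circ> x) ` coset D J w = coset D J (v \<circ> w)"
  by (simp add: coset_def image_image comp_assoc)

lemma coset_comp_cong: "coset D J v = coset D J w \<Longrightarrow> coset D J (u \<circ> v) = coset D J (u \<circ> w)"
  by (metis coset_image)

lemma coset_comp_iff:
  assumes "u \<in> W"
  shows "coset D J (u \<circ> v) = coset D J (u \<circ> w) \<longleftrightarrow> coset D J v = coset D J w"
proof -
  show ?thesis
    using weyl_comp_cancel(1)[OF assms] coset_comp_cong[of J "u \<circ> v" "u \<circ> w" "inv u"]
      coset_comp_cong[of J v w u] by metis
qed

section \<open>Outgoing labels\<close>

text \<open>
  The labels of the edges of the moment graph that are directed out of the vertex \<open>[w]\<close>. With
  \<open>J = {}\<close> these are the inversions of the inverse of \<open>w\<close>.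
\<close>

definition out_labels :: "'n set \<Rightarrow> (complex ^ 'n \<Rightarrow> complex ^ 'n) \<Rightarrow> (complex ^ 'n) set" where
  "out_labels J w = {\<beta> \<in> pos. - inv w \<beta> \<in> pos \<and> coset D J (reflection \<beta> \<circ> w) \<noteq> coset D J w}"

lemma finite_out_labels: "finite (out_labels J w)"
  unfolding out_labels_def using finite_pos by simp

lemma refl_comp_weyl: "w \<in> W \<Longrightarrow> \<beta> \<in> \<Phi> \<Longrightarrow> reflection \<beta> \<circ> w = w \<circ> reflection (inv w \<beta>)"
  using refl_conj[of w "inv w \<beta>"] by (simp only: weyl_roots[OF inv_weyl] inv_weyl_apply)

lemma coset_refl_eq_iff:
  assumes "w \<in> W" "\<beta> \<in> \<Phi>"
  shows "coset D J (reflection \<beta> \<circ> w) = coset D J w \<longleftrightarrow>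
    reflection (inv w \<beta>) \<in> weyl_parabolic D J"
proof -
  have *: "w \<circ> x = w \<circ> y \<longleftrightarrow> x = y" for x y :: "complex ^ 'n \<Rightarrow> complex ^ 'n"
    using weyl_comp_cancel(1)[OF assms(1)] by metis
  show ?thesis
    unfolding refl_comp_weyl[OF assms] coset_eq_iff[OF assms(1)] * by blast
qed

text \<open>
  The reflections in the parabolic subgroup are a union of conjugacy classes of that subgroup, so a
  root whose reflection lies outside never becomes a generating simple root along a word in the
  generators, and hence never changes its sign.
\<close>

lemma parabolic_pos:
  assumes "u \<in> weyl_parabolic D J" "\<beta> \<in> pos" "reflection \<beta> \<notin> weyl_parabolic D J"
  shows "u \<beta> \<in> pos \<and> reflection (u \<beta>) \<notin> weyl_parabolic D J"
  using assms(1) unfolding weyl_parabolic_def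
proof (induction rule: generated.induct)
  case 1
  then show ?case using assms by (simp add: weyl_parabolic_def)
next
  case (2 t u)
  then obtain j where j: "j \<in> J" "t = s j" by blast
  let ?\<gamma> = "u \<beta>"
  have sj: "s j \<in> generated (s ` J)" using j by (simp add: generator_in_generated)
  have \<gamma>: "?\<gamma> \<in> \<Phi>" using 2 pos_root by blast
  have "?\<gamma> \<noteq> \<alpha> j" using 2 sj by metis
  then have "s j ?\<gamma> \<in> pos" using simple_refl_pos 2 by blast
  moreover have "reflection (s j ?\<gamma>) \<notin> generated (s ` J)"
  proof
    assume "reflection (s j ?\<gamma>) \<in> generated (s ` J)"
    then have "s j \<circ> (reflection (s j ?\<gamma>) \<circ> s j) \<in> generated (s ` J)"
      using sj by (intro generated_comp)
    moreover have "s j \<circ> (reflection (s j ?\<gamma>) \<circ> s j) = reflection ?\<gamma>"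
      unfolding refl_conj[OF simple_refl_weyl \<gamma>] by (rule simple_comp_cancel)
    ultimately show False using 2 by metis
  qed
  ultimately show ?case using j by simp
qed

text \<open>
  The label set depends only on the vertex, not on the representative; the inclusion applies to both
  directions of a change of representative.
\<close>

lemma out_labels_mono_coset:
  assumes w: "w \<in> W" and u: "u \<in> weyl_parabolic D J"
  shows "out_labels J w \<subseteq> out_labels J (w \<circ> u)"
proof
  fix \<beta> assume \<beta>: "\<beta> \<in> out_labels J w"
  then have \<Phi>: "\<beta> \<in> \<Phi>" "inv w \<beta> \<in> \<Phi>"
    using pos_root weyl_roots[OF inv_weyl[OF w]] by (auto simp: out_labels_def)
  have uW: "u \<in> W" using u parabolic_subset by blast
  have "reflection (- inv w \<beta>) \<notin> weyl_parabolic D J"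
    using \<beta> coset_refl_eq_iff[OF w \<Phi>(1)] refl_uminus[OF \<Phi>(2)] by (simp add: out_labels_def)
  then have *: "inv u (- inv w \<beta>) \<in> pos"
    using \<beta> parabolic_pos[OF parabolic_inv[OF u]] by (auto simp: out_labels_def)
  have "coset D J (w \<circ> u) = coset D J w" using coset_eq_iff[OF w] u by blast
  with \<beta> * show "\<beta> \<in> out_labels J (w \<circ> u)"
    using coset_comp_cong[of J "w \<circ> u" w "reflection \<beta>"]
    by (simp add: out_labels_def inv_comp_apply[OF w uW] weyl_uminus[OF inv_weyl[OF uW]])
qed

lemma out_labels_cong:
  assumes "v \<in> W" "w \<in> W" "coset D J v = coset D J w"
  shows "out_labels J v = out_labels J w"
proof
  obtain u where "u \<in> weyl_parabolic D J" "v = w \<circ> u" using coset_eq_iff[OF assms(2)] assms(3) by blast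
  then show "out_labels J w \<subseteq> out_labels J v" using out_labels_mono_coset[OF assms(2)] by blast
  obtain u where "u \<in> weyl_parabolic D J" "w = v \<circ> u"
    using coset_eq_iff[OF assms(1), of J w] assms(3) by auto
  then show "out_labels J v \<subseteq> out_labels J w" using out_labels_mono_coset[OF assms(1)] by blast
qed

lemma simple_in_out_labels:
  assumes w: "w \<in> W" and ne: "coset D J (s i \<circ> w) \<noteq> coset D J w"
  shows "\<alpha> i \<in> out_labels J (s i \<circ> w) \<longleftrightarrow> \<alpha> i \<notin> out_labels J w"
proof -
  have "s i \<circ> (s i \<circ> w) = w" by (rule simple_comp_cancel)
  moreover have "inv (s i \<circ> w) (\<alpha> i) = - inv w (\<alpha> i)"
    by (simp add: inv_comp_apply[OF simple_refl_weyl w] inv_refl simple_root refl_self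
        weyl_uminus[OF inv_weyl[OF w]])
  moreover have "- inv w (\<alpha> i) \<in> pos \<longleftrightarrow> inv w (\<alpha> i) \<notin> pos"
    using neg_iff_not_pos weyl_roots[OF inv_weyl[OF w] simple_root] by blast
  ultimately show ?thesis using ne simple_pos[of i] by (auto simp: out_labels_def)
qed

lemma out_labels_simple_subset:
  assumes w: "w \<in> W"
  shows "s i ` (out_labels J w - {\<alpha> i}) \<subseteq> out_labels J (s i \<circ> w) - {\<alpha> i}"
proof
  fix \<gamma> assume "\<gamma> \<in> s i ` (out_labels J w - {\<alpha> i})"
  then obtain \<beta> where \<beta>: "\<beta> \<in> pos" "- inv w \<beta> \<in> pos" "\<beta> \<noteq> \<alpha> i" "\<gamma> = s i \<beta>"
    and ne: "coset D J (reflection \<beta> \<circ> w) \<noteq> coset D J w" by (auto simp: out_labels_def)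
  have \<gamma>: "\<gamma> \<in> pos" using \<beta> simple_refl_pos by blast
  have "inv (s i \<circ> w) \<gamma> = inv w \<beta>"
    using \<beta> by (simp add: inv_comp_apply[OF simple_refl_weyl w] inv_refl simple_root refl_refl)
  moreover have "\<gamma> \<noteq> \<alpha> i"
    using \<beta> refl_refl[OF simple_root, of i \<beta>] refl_self[OF simple_root, of i] pos_not_neg[OF simple_pos]
    by metis
  moreover have "reflection \<gamma> \<circ> (s i \<circ> w) = s i \<circ> (reflection \<beta> \<circ> w)"
    unfolding \<beta>(4) comp_assoc[symmetric] refl_conj[OF simple_refl_weyl pos_root[OF \<beta>(1)]] ..
  ultimately show "\<gamma> \<in> out_labels J (s i \<circ> w) - {\<alpha> i}"
    using \<beta> \<gamma> ne coset_comp_iff[OF simple_refl_weyl] by (simp add: out_labels_def)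
qed

text \<open>
  Left multiplication by \<open>s i\<close> takes an edge with label \<open>\<beta> \<noteq> \<alpha> i\<close> to an edge with label \<open>s i \<beta>\<close> and
  the same direction, since \<open>s i \<beta>\<close> is again positive; it reverses the edges with label \<open>\<alpha> i\<close>.
\<close>

lemma out_labels_simple:
  assumes w: "w \<in> W"
  shows "out_labels J (s i \<circ> w) - {\<alpha> i} = s i ` (out_labels J w - {\<alpha> i})"
proof
  have "s i \<circ> (s i \<circ> w) = w" by (rule simple_comp_cancel)
  \<comment> \<open>the inclusion for \<open>s i \<circ> w\<close> is the converse inclusion for \<open>w\<close>, as \<open>s i\<close> is an involution\<close>
  then have "s i ` (out_labels J (s i \<circ> w) - {\<alpha> i}) \<subseteq> out_labels J w - {\<alpha> i}"
    using out_labels_simple_subset[OF comp_weyl[OF simple_refl_weyl w], of i J i] by simp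
  then have "s i ` s i ` (out_labels J (s i \<circ> w) - {\<alpha> i}) \<subseteq> s i ` (out_labels J w - {\<alpha> i})"
    by (rule image_mono)
  then show "out_labels J (s i \<circ> w) - {\<alpha> i} \<subseteq> s i ` (out_labels J w - {\<alpha> i})"
    by (simp add: image_image refl_refl simple_root)
qed (rule out_labels_simple_subset[OF w])

lemma inj_simple_refl: "inj (s i)"
  using weyl_bij[OF simple_refl_weyl] by (rule bij_is_inj)

lemma out_labels_down:
  assumes w: "w \<in> W" and i: "\<alpha> i \<in> out_labels J w"
  shows "out_labels J w = insert (\<alpha> i) (s i ` out_labels J (s i \<circ> w))"
    and "\<alpha> i \<notin> out_labels J (s i \<circ> w)" and "\<alpha> i \<notin> s i ` out_labels J (s i \<circ> w)"
    and "card (out_labels J w) = Suc (card (out_labels J (s i \<circ> w)))"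
proof -
  have ne: "coset D J (s i \<circ> w) \<noteq> coset D J w" using i by (simp add: out_labels_def)
  show no: "\<alpha> i \<notin> out_labels J (s i \<circ> w)" using simple_in_out_labels[OF w ne] i by blast
  have eq: "out_labels J (s i \<circ> w) = s i ` (out_labels J w - {\<alpha> i})"
    using out_labels_simple[OF w, of J i] no by simp
  then have eq': "s i ` out_labels J (s i \<circ> w) = out_labels J w - {\<alpha> i}"
    by (simp add: image_image refl_refl simple_root)
  then show "out_labels J w = insert (\<alpha> i) (s i ` out_labels J (s i \<circ> w))"
    and "\<alpha> i \<notin> s i ` out_labels J (s i \<circ> w)" using i by auto
  have "card (out_labels J (s i \<circ> w)) = card (s i ` out_labels J (s i \<circ> w))"
    using inj_simple_refl by (metis card_image inj_on_subset subset_UNIV)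
  then show "card (out_labels J w) = Suc (card (out_labels J (s i \<circ> w)))"
    unfolding eq' using card_Suc_Diff1[OF finite_out_labels i] by simp
qed

lemma card_out_labels_simple_le:
  assumes w: "w \<in> W"
  shows "card (out_labels J (s i \<circ> w)) \<le> Suc (card (out_labels J w))"
proof (cases "coset D J (s i \<circ> w) = coset D J w")
  case True
  then show ?thesis using out_labels_cong[OF comp_weyl[OF simple_refl_weyl w] w] by simp
next
  case False
  have ss: "s i \<circ> (s i \<circ> w) = w" by (rule simple_comp_cancel)
  show ?thesis
  proof (cases "\<alpha> i \<in> out_labels J w")
    case True
    then show ?thesis using out_labels_down(4)[OF w] by simp
  next
    case no: False
    then have "\<alpha> i \<in> out_labels J (s i \<circ> w)" using simple_in_out_labels[OF w False] by blast
    then show ?thesis using out_labels_down(4)[OF comp_weyl[OF simple_refl_weyl w]] ss by simp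
  qed
qed

section \<open>Length and outgoing labels\<close>

lemma coset_empty: "coset D {} w = {w}"
proof -
  have "u = id" if "u \<in> generated {}" for u :: "complex ^ 'n \<Rightarrow> complex ^ 'n"
    using that by induction auto
  then have "weyl_parabolic D {} = {id}"
    using generated.intros(1)[of "{}"] by (auto simp: weyl_parabolic_def)
  then show ?thesis by (simp add: coset_def)
qed

lemma refl_comp_neq:
  assumes "\<beta> \<in> \<Phi>" "w \<in> W" shows "reflection \<beta> \<circ> w \<noteq> w"
proof
  assume "reflection \<beta> \<circ> w = w"
  then have "reflection \<beta> (w (inv w \<beta>)) = w (inv w \<beta>)" by (metis comp_apply)
  then have "- \<beta> = \<beta>" using assms by (simp add: inv_weyl_apply refl_self)
  then show False using assms zero_not_root pos_or_neg pos_not_neg by metis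
qed

lemma out_labels_empty: "w \<in> W \<Longrightarrow> out_labels {} w = {\<beta> \<in> pos. - inv w \<beta> \<in> pos}"
  using refl_comp_neq pos_root by (auto simp: out_labels_def coset_empty)

text \<open>
  Along a reduced word every letter adds an inversion: otherwise the exchange property would shorten
  the word.
\<close>

lemma len_eq_inversions: "w \<in> W \<Longrightarrow> len w = card (out_labels {} w)"
proof (induction "len w" arbitrary: w)
  case 0
  then have "w = id" by (metis length_0_conv reduced_word word_simps(1))
  then have "out_labels {} w = {}" using pos_not_neg by (auto simp: out_labels_def)
  then show ?case using 0 by simp
next
  case (Suc n)
  obtain "is" where "is": "w = word is" "length is = len w" by (rule reduced_word[OF Suc.prems])
  then obtain i js where ijs: "is = i # js" "length js = n"
    using Suc.hyps(2) by (metis length_Suc_conv)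
  let ?v = "word js"
  have w: "w = s i \<circ> ?v" using "is" ijs by simp
  have v: "?v \<in> W" by (rule word_weyl)
  have len: "len ?v = n"
    using len_word_le[of js] len_simple_le[OF v, of i] ijs w Suc.hyps(2) by simp
  have sw: "s i \<circ> w = ?v" unfolding w by (rule simple_comp_cancel)
  have "- inv ?v (\<alpha> i) \<notin> pos"
    using len_refl_less[OF v simple_pos, of i] w Suc.hyps(2) len by auto
  then have "\<alpha> i \<notin> out_labels {} ?v" by (simp add: out_labels_def)
  moreover have "coset D {} (s i \<circ> ?v) \<noteq> coset D {} ?v"
    using refl_comp_neq[OF simple_root v] by (simp add: coset_empty)
  ultimately have "\<alpha> i \<in> out_labels {} w" using simple_in_out_labels[OF v] w by blast
  then have "card (out_labels {} w) = Suc (card (out_labels {} ?v))"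
    using out_labels_down(4)[OF Suc.prems] sw by simp
  then show ?case using Suc.hyps(1)[OF _ v] len Suc.hyps(2) by simp
qed

lemma card_out_labels_le_len:
  assumes "w \<in> W" shows "card (out_labels J w) \<le> len w"
  unfolding len_eq_inversions[OF assms] out_labels_empty[OF assms]
  by (rule card_mono) (auto simp: out_labels_def finite_pos)

lemma min_rep_exists:
  obtains u where "is_min_rep D u (coset D J w)"
  using exists_least_iff[of "\<lambda>n. \<exists>u\<in>coset D J w. len u = n"] coset_self[of w J]
  unfolding is_min_rep_def by (metis not_le)

lemma min_rep_weyl:
  assumes "w \<in> W" "is_min_rep D u (coset D J w)"
  shows "u \<in> W" "coset D J u = coset D J w"
  using in_coset[OF assms(1)] assms(2) by (auto simp: is_min_rep_def)

text \<open>
  For a minimal representative every inversion is an outgoing label: an inversion whose reflection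
  stays in the coset would yield a shorter representative.
\<close>

lemma len_min_rep:
  assumes w: "w \<in> W" and u: "is_min_rep D u (coset D J w)"
  shows "len u = card (out_labels J w)"
proof -
  note uW = min_rep_weyl[OF w u]
  have "out_labels {} u \<subseteq> out_labels J u"
  proof
    fix \<beta> assume "\<beta> \<in> out_labels {} u"
    then have \<beta>: "\<beta> \<in> pos" "- inv u \<beta> \<in> pos" by (auto simp: out_labels_def)
    then have "reflection \<beta> \<circ> u \<notin> coset D J w"
      using len_refl_less[OF uW(1)] u by (auto simp: is_min_rep_def not_le[symmetric])
    then have "coset D J (reflection \<beta> \<circ> u) \<noteq> coset D J u"
      using coset_self uW(2) by metis
    then show "\<beta> \<in> out_labels J u" using \<beta> by (simp add: out_labels_def)
  qed
  then have "len u \<le> card (out_labels J u)"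
    unfolding len_eq_inversions[OF uW(1)] by (rule card_mono[OF finite_out_labels])
  then show ?thesis
    using card_out_labels_le_len[OF uW(1), of J] out_labels_cong[OF uW(1) w uW(2)] by simp
qed

text \<open>
  Measured at a minimal representative, rank is length; and reflecting along an inversion lowers
  the length.
\<close>

lemma card_out_labels_refl_less:
  assumes w: "w \<in> W" and \<beta>: "\<beta> \<in> out_labels J w"
  shows "card (out_labels J (reflection \<beta> \<circ> w)) < card (out_labels J w)"
proof -
  obtain u where u: "is_min_rep D u (coset D J w)" by (rule min_rep_exists)
  note uW = min_rep_weyl[OF w u]
  have \<beta>': "\<beta> \<in> pos" "- inv u \<beta> \<in> pos"
    using \<beta> out_labels_cong[OF uW(1) w uW(2)] by (auto simp: out_labels_def)
  have W: "reflection \<beta> \<circ> x \<in> W" if "x \<in> W" for x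
    using comp_weyl refl_weyl \<beta>'(1) pos_root that by blast
  have "card (out_labels J (reflection \<beta> \<circ> w)) = card (out_labels J (reflection \<beta> \<circ> u))"
    using out_labels_cong[OF W W coset_comp_cong] uW w by metis
  also have "\<dots> \<le> len (reflection \<beta> \<circ> u)" by (rule card_out_labels_le_len[OF W[OF uW(1)]])
  also have "\<dots> < len u" by (rule len_refl_less[OF uW(1) \<beta>'])
  finally show ?thesis by (simp add: len_min_rep[OF w u])
qed

section \<open>Bruhat order on cosets\<close>

lemma bruhat_len: "bruhat D u v \<Longrightarrow> u = v \<or> len u < len v"
  unfolding bruhat_def by (induction rule: rtranclp_induct) auto

lemma coset_le_card:
  assumes "v \<in> W" "w \<in> W" "coset_le D (coset D J v) (coset D J w)"
  shows "coset D J v = coset D J w \<or> card (out_labels J v) < card (out_labels J w)"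
proof -
  obtain x y where xy: "is_min_rep D x (coset D J v)" "is_min_rep D y (coset D J w)" "bruhat D x y"
    using assms(3) by (auto simp: coset_le_def)
  then show ?thesis
    using bruhat_len[OF xy(3)] len_min_rep[OF assms(1) xy(1)] len_min_rep[OF assms(2) xy(2)]
      min_rep_weyl(2)[OF assms(1) xy(1)] min_rep_weyl(2)[OF assms(2) xy(2)] by metis
qed

lemma coset_le_refl: "coset_le D (coset D J w) (coset D J w)"
proof -
  obtain u where "is_min_rep D u (coset D J w)" by (rule min_rep_exists)
  then show ?thesis unfolding coset_le_def bruhat_def by blast
qed

text \<open>
  The image of a minimal representative of \<open>[s\<^sub>i w]\<close> under \<open>s i\<close> has length at most the rank of \<open>[w]\<close>,
  hence is itself a minimal representative.
\<close>

lemma coset_le_simple: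
  assumes w: "w \<in> W" and i: "\<alpha> i \<in> out_labels J w"
  shows "coset_le D (coset D J (s i \<circ> w)) (coset D J w)"
proof -
  have sw: "s i \<circ> w \<in> W" by (rule comp_weyl[OF simple_refl_weyl w])
  obtain u where u: "is_min_rep D u (coset D J (s i \<circ> w))" by (rule min_rep_exists)
  note uW = min_rep_weyl[OF sw u]
  have "s i \<circ> (s i \<circ> w) = w" by (rule simple_comp_cancel)
  then have coset: "coset D J (s i \<circ> u) = coset D J w" using coset_comp_cong[OF uW(2)] by metis
  have su: "s i \<circ> u \<in> W" by (rule comp_weyl[OF simple_refl_weyl uW(1)])
  have len_su: "len (s i \<circ> u) \<le> card (out_labels J w)"
    using len_simple_le[OF uW(1), of i] len_min_rep[OF sw u] out_labels_down(4)[OF w i] by simp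
  have "len (s i \<circ> u) \<le> len v" if "v \<in> coset D J w" for v
    using card_out_labels_le_len[of v J] out_labels_cong[of v w J] in_coset[OF w that] w len_su by simp
  then have min: "is_min_rep D (s i \<circ> u) (coset D J w)"
    using coset_self[of "s i \<circ> u" J] coset by (auto simp: is_min_rep_def)
  have "len u < len (s i \<circ> u)"
    using len_min_rep[OF sw u] len_min_rep[OF w min] out_labels_down(4)[OF w i] by simp
  then have "bruhat D u (s i \<circ> u)"
    unfolding bruhat_def using uW(1) simple_root by blast
  then show ?thesis using u min by (auto simp: coset_le_def)
qed


section \<open>GKM classes and divided differences\<close>

text \<open>
  The edge condition for arbitrary roots, so that labels may be moved by the Weyl group without
  regard to sign.
\<close>

lemma gkm_dvd:
  assumes "gkm_class D J p" "w \<in> W" "\<beta> \<in> \<Phi>"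
  shows "sym_of \<beta> dvd p (coset D J (reflection \<beta> \<circ> w)) - p (coset D J w)"
proof (cases "coset D J (reflection \<beta> \<circ> w) = coset D J w")
  case ne: False
  show ?thesis
  proof (cases "\<beta> \<in> pos")
    case True
    then show ?thesis using assms ne unfolding gkm_class_def by blast
  next
    case False
    then have "- \<beta> \<in> pos" using neg_iff_not_pos assms(3) by blast
    then have "sym_of (- \<beta>) dvd p (coset D J (reflection \<beta> \<circ> w)) - p (coset D J w)"
      using assms ne refl_uminus[OF assms(3)] unfolding gkm_class_def by metis
    then show ?thesis by (simp add: sym_of_minus)
  qed
qed simp

lemma sym_map_refl_cong: "sym_of \<beta> dvd f - sym_map (reflection \<beta>) f"
  by (rule sym_of_dvd_diff_sym_map) (simp add: refl_root_def)

lemma sym_map_refl_refl: "\<beta> \<in> \<Phi> \<Longrightarrow> sym_map (reflection \<beta>) (sym_map (reflection \<beta>) f) = f"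
  by (simp only: sym_map_compose[OF linear_refl] refl_invol sym_map_id)

lemma weyl_act_coset: "weyl_act (s i) p (coset D J w) = sym_map (s i) (p (coset D J (s i \<circ> w)))"
  by (simp only: weyl_act_def inv_refl[OF simple_root] coset_image)

lemma simple_neq_0: "\<alpha> i \<noteq> 0"
  using simple_root zero_not_root by metis

lemma weyl_act_gkm_dvd:
  assumes p: "gkm_class D J p" and w: "w \<in> W" and \<beta>: "\<beta> \<in> \<Phi>"
  shows "sym_of \<beta> dvd
    weyl_act (s i) p (coset D J (reflection \<beta> \<circ> w)) - weyl_act (s i) p (coset D J w)"
proof -
  have "reflection (s i \<beta>) \<circ> (s i \<circ> w) = s i \<circ> (reflection \<beta> \<circ> w)"
    unfolding comp_assoc[symmetric] refl_conj[OF simple_refl_weyl \<beta>] ..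
  then have "sym_of (s i \<beta>) dvd
      p (coset D J (s i \<circ> (reflection \<beta> \<circ> w))) - p (coset D J (s i \<circ> w))"
    using gkm_dvd[OF p comp_weyl[OF simple_refl_weyl w] refl_in_roots[OF simple_root \<beta>]] by metis
  then have "sym_map (s i) (sym_of (s i \<beta>)) dvd sym_map (s i)
      (p (coset D J (s i \<circ> (reflection \<beta> \<circ> w))) - p (coset D J (s i \<circ> w)))"
    by (rule sym_map_dvd)
  then show ?thesis
    by (simp only: sym_map_sym_of[OF linear_refl] refl_refl[OF simple_root] sym_map_diff weyl_act_coset)
qed

text \<open>
  The left divided difference. It exists because \<open>p\<close> satisfies the edge condition for \<open>\<alpha> i\<close> and
  \<open>s i\<close> acts trivially modulo \<open>\<alpha> i\<close>. It inherits the edge condition for the other labels because the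
  prime \<open>\<alpha> i\<close> is not associated to them.
\<close>

lemma divided_difference:
  assumes p: "gkm_class D J p"
  obtains q where "gkm_class D J q"
    and "\<And>w. w \<in> W \<Longrightarrow>
      p (coset D J w) - weyl_act (s i) p (coset D J w) = sym_of (\<alpha> i) * q (coset D J w)"
proof -
  let ?r = "\<lambda>X. p X - weyl_act (s i) p X"
  let ?a = "sym_of (\<alpha> i)"
  have dvd: "?a dvd ?r (coset D J w)" if w: "w \<in> W" for w
  proof -
    let ?f = "p (coset D J (s i \<circ> w))"
    have "?a dvd (?f - sym_map (s i) ?f) - (?f - p (coset D J w))"
      using sym_map_refl_cong gkm_dvd[OF p w simple_root] by (rule dvd_diff)
    then show ?thesis by (simp add: weyl_act_coset)
  qed
  define q where "q X = (SOME f. ?r X = ?a * f)" for X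
  have q: "?r (coset D J w) = ?a * q (coset D J w)" if "w \<in> W" for w
    using dvd[OF that] unfolding q_def dvd_def by (rule someI_ex)
  \<comment> \<open>the quotient commutes with \<open>s i\<close>; this yields its edge condition for the label \<open>\<alpha> i\<close>, which cannot be cancelled against the factor \<open>\<alpha> i\<close>\<close>
  have q_simple: "q (coset D J (s i \<circ> w)) = sym_map (s i) (q (coset D J w))" if w: "w \<in> W" for w
  proof (rule linear_form_mult_cancel[OF _ simple_neq_0])
    have "?a * q (coset D J (s i \<circ> w)) = - sym_map (s i) (?r (coset D J w))"
      unfolding q[OF comp_weyl[OF simple_refl_weyl w], symmetric]
      by (simp only: weyl_act_coset simple_comp_cancel sym_map_diff sym_map_refl_refl[OF simple_root])
         simp
    also have "\<dots> = ?a * sym_map (s i) (q (coset D J w))"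
      by (simp add: q[OF w] sym_map_mult sym_map_sym_of[OF linear_refl] refl_self simple_root sym_of_minus)
    finally show "?a * q (coset D J (s i \<circ> w)) = ?a * sym_map (s i) (q (coset D J w))" .
  qed
  have "gkm_class D J q"
    unfolding gkm_class_def
  proof (intro ballI impI)
    fix w \<beta> assume w: "w \<in> W" and \<beta>: "\<beta> \<in> pos"
    note \<beta>\<Phi> = pos_root[OF \<beta>]
    let ?w' = "reflection \<beta> \<circ> w"
    have w': "?w' \<in> W" using comp_weyl refl_weyl \<beta>\<Phi> w by blast
    show "sym_of \<beta> dvd q (coset D J ?w') - q (coset D J w)"
    proof (cases "\<beta> = \<alpha> i")
      case True
      have "?a dvd - (q (coset D J w) - sym_map (s i) (q (coset D J w)))"
        unfolding dvd_minus_iff by (rule sym_map_refl_cong)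
      then show ?thesis unfolding True q_simple[OF w] by simp
    next
      case False
      have "sym_of \<beta> dvd (p (coset D J ?w') - p (coset D J w))
          - (weyl_act (s i) p (coset D J ?w') - weyl_act (s i) p (coset D J w))"
        using gkm_dvd[OF p w \<beta>\<Phi>] weyl_act_gkm_dvd[OF p w \<beta>\<Phi>] by (rule dvd_diff)
      also have "\<dots> = ?r (coset D J ?w') - ?r (coset D J w)" by (simp only: algebra_simps)
      also have "\<dots> = ?a * (q (coset D J ?w') - q (coset D J w))"
        by (simp only: q[OF w] q[OF w'] right_diff_distrib)
      finally show ?thesis
      proof (rule linear_form_prime)
        show "\<beta> \<noteq> 0" using \<beta>\<Phi> zero_not_root by blast
        show "\<alpha> i \<noteq> c *s \<beta>" for c
        proof
          assume eq: "\<alpha> i = c *s \<beta>"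
          then have "c = 1 \<or> c = -1" using reduced[OF \<beta>\<Phi>] simple_root by metis
          then have "\<alpha> i = \<beta> \<or> \<alpha> i = - \<beta>" using eq by auto
          then show False using False pos_not_neg[OF \<beta>] simple_pos by metis
        qed
      qed
    qed
  qed
  then show ?thesis using q by (rule that)
qed

lemma pos_proportional:
  assumes "\<beta> \<in> pos" "\<gamma> \<in> pos" "\<beta> = c *s \<gamma>"
  shows "\<beta> = \<gamma>"
proof -
  have "c = 1 \<or> c = -1" using reduced[OF pos_root[OF assms(2)]] pos_root[OF assms(1)] assms(3) by metis
  then have "\<beta> = \<gamma> \<or> \<beta> = - \<gamma>" using assms(3) by auto
  then show ?thesis using pos_not_neg[OF assms(2)] assms(1) by metis
qed

text \<open>
  At a vertex of the support with the fewest outgoing edges, every outgoing edge ends at a zero of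
  \<open>h\<close>, so the value of \<open>h\<close> is divisible by the product of the outgoing labels. The degree of \<open>h\<close> is
  stated through a multiple \<open>v h\<close>, because the classes to which the lemma is applied are quotients by
  a linear form.
\<close>

lemma gkm_support_vertex:
  assumes h: "gkm_class D J h" and v: "v \<noteq> 0"
    and hom: "\<And>w. w \<in> W \<Longrightarrow> homogeneous d (sym_of v * h (coset D J w))"
    and w0: "w0 \<in> W" "h (coset D J w0) \<noteq> 0"
  obtains w where "w \<in> W" "h (coset D J w) \<noteq> 0" "card (out_labels J w) < d"
proof -
  let ?P = "\<lambda>w. w \<in> W \<and> h (coset D J w) \<noteq> 0"
  obtain w where w: "w \<in> W" "h (coset D J w) \<noteq> 0"
    and min: "\<And>u. ?P u \<Longrightarrow> card (out_labels J w) \<le> card (out_labels J u)"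
    using ex_has_least_nat[of ?P w0 "\<lambda>w. card (out_labels J w)"] w0 by blast
  let ?h = "h (coset D J w)"
  have pos: "\<beta> \<in> pos" if "\<beta> \<in> out_labels J w" for \<beta> using that by (simp add: out_labels_def)
  have "(\<Prod>\<beta>\<in>out_labels J w. sym_of \<beta>) dvd ?h"
  proof (rule prod_linear_forms_dvd[OF finite_out_labels])
    show "0 \<notin> out_labels J w" using pos pos_root zero_not_root by blast
    show "\<beta> = \<gamma>" if "\<beta> \<in> out_labels J w" "\<gamma> \<in> out_labels J w" "\<beta> = c *s \<gamma>" for \<beta> \<gamma> c
      using pos_proportional pos that by blast
    fix \<beta> assume \<beta>: "\<beta> \<in> out_labels J w"
    have \<beta>\<Phi>: "\<beta> \<in> \<Phi>" using pos[OF \<beta>] pos_root by blast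
    have "reflection \<beta> \<circ> w \<in> W" using comp_weyl refl_weyl \<beta>\<Phi> w(1) by blast
    then have "h (coset D J (reflection \<beta> \<circ> w)) = 0"
      using card_out_labels_refl_less[OF w(1) \<beta>] min not_le by blast
    then show "sym_of \<beta> dvd ?h" using gkm_dvd[OF h w(1) \<beta>\<Phi>] by simp
  qed
  then have "sym_of v * (\<Prod>\<beta>\<in>out_labels J w. sym_of \<beta>) dvd sym_of v * ?h"
    by (rule mult_dvd_mono[OF dvd_refl])
  moreover have "homogeneous (1 + (\<Sum>\<beta>\<in>out_labels J w. 1)) (sym_of v * (\<Prod>\<beta>\<in>out_labels J w. sym_of \<beta>))"
    by (intro homogeneous_mult homogeneous_prod homogeneous_sym_of)
  moreover have "sym_of v * ?h \<noteq> 0" using w(2) v linear_form_mult_eq_0 by blast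
  ultimately have "1 + (\<Sum>\<beta>\<in>out_labels J w. 1) \<le> d"
    using homogeneous_dvd_degree[OF hom[OF w(1)]] by blast
  then show ?thesis using w by (intro that) auto
qed

section \<open>Flow-up classes\<close>

text \<open>
  An edge with label \<open>\<beta>\<close> is recorded at either of its ends; if the given representative belongs to
  the target, its reflection is a representative of the source.
\<close>

lemma moment_edges_out:
  assumes w: "w \<in> W"
  shows "{(\<beta>, Y). moment_edge D J (coset D J w) \<beta> Y} =
    (\<lambda>\<beta>. (\<beta>, coset D J (reflection \<beta> \<circ> w))) ` out_labels J w"
proof (intro equalityI subsetI)
  fix e assume "e \<in> {(\<beta>, Y). moment_edge D J (coset D J w) \<beta> Y}"
  then obtain \<beta> Y v where e: "e = (\<beta>, Y)" and \<beta>: "\<beta> \<in> pos" and v: "v \<in> W"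
    and ne: "coset D J (reflection \<beta> \<circ> v) \<noteq> coset D J v"
    and edge: "if - inv v \<beta> \<in> pos
         then coset D J w = coset D J v \<and> Y = coset D J (reflection \<beta> \<circ> v)
         else coset D J w = coset D J (reflection \<beta> \<circ> v) \<and> Y = coset D J v"
    unfolding moment_edge_def by blast
  note \<beta>\<Phi> = pos_root[OF \<beta>]
  have "\<exists>u\<in>W. coset D J w = coset D J u \<and> - inv u \<beta> \<in> pos \<and>
      coset D J (reflection \<beta> \<circ> u) \<noteq> coset D J u \<and> Y = coset D J (reflection \<beta> \<circ> u)"
  proof (cases "- inv v \<beta> \<in> pos")
    case True
    then show ?thesis using v ne edge by auto
  next
    case False
    let ?u = "reflection \<beta> \<circ> v"
    have "inv ?u \<beta> = - inv v \<beta>"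
      by (simp only: inv_comp_apply[OF refl_weyl[OF \<beta>\<Phi>] v] inv_refl[OF \<beta>\<Phi>] refl_self[OF \<beta>\<Phi>]
          weyl_uminus[OF inv_weyl[OF v]])
    then have "- inv ?u \<beta> \<in> pos"
      using False neg_iff_not_pos[OF weyl_roots[OF inv_weyl[OF v] \<beta>\<Phi>]] by simp
    moreover have "?u \<in> W" using comp_weyl refl_weyl \<beta>\<Phi> v by blast
    moreover have "reflection \<beta> \<circ> ?u = v" by (rule refl_comp_cancel[OF \<beta>\<Phi>])
    ultimately show ?thesis using False ne edge by metis
  qed
  then obtain u where u: "u \<in> W" "coset D J w = coset D J u" "\<beta> \<in> out_labels J u"
      "Y = coset D J (reflection \<beta> \<circ> u)"
    using \<beta> by (auto simp: out_labels_def)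
  have "\<beta> \<in> out_labels J w" using out_labels_cong[OF w u(1,2)] u(3) by simp
  moreover have "Y = coset D J (reflection \<beta> \<circ> w)" using coset_comp_cong[OF u(2)] u(4) by simp
  ultimately show "e \<in> (\<lambda>\<beta>. (\<beta>, coset D J (reflection \<beta> \<circ> w))) ` out_labels J w"
    unfolding e by blast
next
  fix e assume "e \<in> (\<lambda>\<beta>. (\<beta>, coset D J (reflection \<beta> \<circ> w))) ` out_labels J w"
  then obtain \<beta> where "\<beta> \<in> out_labels J w" and e: "e = (\<beta>, coset D J (reflection \<beta> \<circ> w))" by blast
  then have "moment_edge D J (coset D J w) \<beta> (coset D J (reflection \<beta> \<circ> w))"
    using w by (auto simp: moment_edge_def out_labels_def intro!: bexI[of _ w])
  then show "e \<in> {(\<beta>, Y). moment_edge D J (coset D J w) \<beta> Y}" unfolding e by simp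
qed

lemma flow_up_class_at:
  assumes w: "w \<in> W" and p: "flow_up_class D J (coset D J w) p"
  shows "p (coset D J w) = (\<Prod>\<beta>\<in>out_labels J w. sym_of \<beta>)"
proof -
  have "inj_on (\<lambda>\<beta>. (\<beta>, coset D J (reflection \<beta> \<circ> w))) (out_labels J w)"
    by (rule inj_onI) simp
  then show ?thesis
    using p unfolding flow_up_class_def moment_edges_out[OF w] by (simp add: prod.reindex)
qed

lemma flow_up_class_homogeneous:
  assumes w: "w \<in> W" and p: "flow_up_class D J (coset D J w) p" and v: "v \<in> W"
  shows "homogeneous (card (out_labels J w)) (p (coset D J v))"
proof -
  obtain d where d: "\<And>X. X \<in> cosets D J \<Longrightarrow> homogeneous d (p X)"
    using p by (auto simp: flow_up_class_def homogeneous_class_def)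
  have "homogeneous (\<Sum>\<beta>\<in>out_labels J w. 1) (p (coset D J w))"
    unfolding flow_up_class_at[OF w p] by (intro homogeneous_prod homogeneous_sym_of)
  moreover have "p (coset D J w) \<noteq> 0"
    using p coset_le_refl w by (auto simp: flow_up_class_def cosets_def)
  moreover have "homogeneous d (p (coset D J w))" using d w by (simp add: cosets_def)
  ultimately have "d = card (out_labels J w)" using homogeneous_unique by fastforce
  then show ?thesis using d v by (simp add: cosets_def)
qed

lemma flow_up_class_support:
  assumes w: "w \<in> W" and p: "flow_up_class D J (coset D J w) p" and v: "v \<in> W"
    and "p (coset D J v) \<noteq> 0"
  shows "coset D J w = coset D J v \<or> card (out_labels J w) < card (out_labels J v)"
  using assms coset_le_card[OF w v] by (auto simp: flow_up_class_def cosets_def)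

section \<open>The action of a simple reflection\<close>

text \<open>
  Since \<open>p\<close> vanishes at \<open>[v]\<close> for reasons of rank, \<open>[s\<^sub>i v]\<close> lies above \<open>[w]\<close>. Its rank exceeds that of
  \<open>[v]\<close> by at most one, so it does not exceed the rank of \<open>[w]\<close>, and the two vertices coincide.
\<close>

lemma flow_up_class_support_act:
  assumes w: "w \<in> W" and p: "flow_up_class D J (coset D J w) p" and v: "v \<in> W"
    and low: "card (out_labels J v) < card (out_labels J w)"
    and ne: "p (coset D J v) - weyl_act (s i) p (coset D J v) \<noteq> 0"
  shows "coset D J v = coset D J (s i \<circ> w)"
proof -
  have sv: "s i \<circ> v \<in> W" by (rule comp_weyl[OF simple_refl_weyl v])
  have "p (coset D J v) = 0"
    using flow_up_class_support[OF w p v] low out_labels_cong[OF w v] by (metis less_irrefl less_asym)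
  then have "p (coset D J (s i \<circ> v)) \<noteq> 0"
    using ne by (auto simp: weyl_act_coset sym_map_0)
  then have "coset D J w = coset D J (s i \<circ> v)"
    using flow_up_class_support[OF w p sv] card_out_labels_simple_le[OF v, of J i] low by auto
  then show ?thesis using coset_comp_cong[of J w "s i \<circ> v" "s i"] simple_comp_cancel by metis
qed

lemma homogeneous_class_diff_act:
  assumes w: "w \<in> W" and p: "flow_up_class D J (coset D J w) p" and v: "v \<in> W"
  shows "homogeneous (card (out_labels J w)) (p (coset D J v) - weyl_act (s i) p (coset D J v))"
  unfolding weyl_act_coset
  by (intro homogeneous_diff homogeneous_sym_map flow_up_class_homogeneous[OF w p]
      v comp_weyl[OF simple_refl_weyl v])

text \<open>
  The divided difference has degree below the rank of \<open>[w]\<close>; if it were nonzero, it would be so at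
  a vertex of rank below that of \<open>[w]\<close>. This could only be \<open>[s\<^sub>i w]\<close>, which here has rank at least
  that of \<open>[w]\<close>.
\<close>

lemma simple_act_up:
  assumes w: "w \<in> W" and p: "flow_up_class D J (coset D J w) p"
    and le: "coset_le D (coset D J w) (coset D J (s i \<circ> w))" and v: "v \<in> W"
  shows "weyl_act (s i) p (coset D J v) = p (coset D J v)"
proof -
  have gkm: "gkm_class D J p" using p by (simp add: flow_up_class_def)
  obtain q where q: "gkm_class D J q"
    "\<And>w. w \<in> W \<Longrightarrow>
      p (coset D J w) - weyl_act (s i) p (coset D J w) = sym_of (\<alpha> i) * q (coset D J w)"
    using divided_difference[OF gkm] by blast
  have "q (coset D J v) = 0"
  proof (rule ccontr)
    assume ne: "q (coset D J v) \<noteq> 0"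
    have hom: "homogeneous (card (out_labels J w)) (sym_of (\<alpha> i) * q (coset D J u))" if "u \<in> W" for u
      using homogeneous_class_diff_act[OF w p that, of i] q(2)[OF that] by simp
    obtain u where u: "u \<in> W" "q (coset D J u) \<noteq> 0" "card (out_labels J u) < card (out_labels J w)"
      using gkm_support_vertex[OF q(1) simple_neq_0 hom v ne] by blast
    have sw: "s i \<circ> w \<in> W" by (rule comp_weyl[OF simple_refl_weyl w])
    have "sym_of (\<alpha> i) * q (coset D J u) \<noteq> 0" using u(2) linear_form_mult_eq_0 simple_neq_0 by blast
    then have "coset D J u = coset D J (s i \<circ> w)"
      using flow_up_class_support_act[OF w p u(1) u(3), of i] q(2)[OF u(1)] by metis
    then have "card (out_labels J u) = card (out_labels J (s i \<circ> w))"
      using out_labels_cong[OF u(1) sw] by simp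
    moreover have "card (out_labels J w) \<le> card (out_labels J (s i \<circ> w))"
      using coset_le_card[OF w sw le] out_labels_cong[OF w sw] by auto
    ultimately show False using u(3) by simp
  qed
  then show ?thesis using q(2)[OF v] by simp
qed

text \<open>
  At \<open>[s\<^sub>i w]\<close> only the term coming from \<open>[w]\<close> survives. Its value is the product of the outgoing
  labels of \<open>[w]\<close>, which are \<open>\<alpha> i\<close> and the \<open>s i\<close>-images of those of \<open>[s\<^sub>i w]\<close>.
\<close>

lemma simple_act_at_lower:
  assumes w: "w \<in> W" and p: "flow_up_class D J (coset D J w) p"
    and i: "\<alpha> i \<in> out_labels J w"
    and q: "flow_up_class D J (coset D J (s i \<circ> w)) q"
  shows "p (coset D J (s i \<circ> w)) - weyl_act (s i) p (coset D J (s i \<circ> w))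
    = sym_of (\<alpha> i) * q (coset D J (s i \<circ> w))"
proof -
  have sw: "s i \<circ> w \<in> W" by (rule comp_weyl[OF simple_refl_weyl w])
  note down = out_labels_down[OF w i]
  have "coset D J w \<noteq> coset D J (s i \<circ> w)" using i by (auto simp: out_labels_def)
  then have zero: "p (coset D J (s i \<circ> w)) = 0"
    using flow_up_class_support[OF w p sw] down(4) by auto
  have "p (coset D J w) = sym_of (\<alpha> i) * (\<Prod>\<beta>\<in>s i ` out_labels J (s i \<circ> w). sym_of \<beta>)"
    unfolding flow_up_class_at[OF w p]
    by (subst down(1)) (rule prod.insert[OF finite_imageI[OF finite_out_labels] down(3)])
  also have "\<dots> = sym_of (\<alpha> i) * (\<Prod>\<beta>\<in>out_labels J (s i \<circ> w). sym_of (s i \<beta>))"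
    by (subst prod.reindex[OF inj_on_subset[OF inj_simple_refl subset_UNIV]]) simp
  finally have "sym_map (s i) (p (coset D J w)) =
      - sym_of (\<alpha> i) * (\<Prod>\<beta>\<in>out_labels J (s i \<circ> w). sym_of \<beta>)"
    by (simp add: sym_map_mult sym_map_prod sym_map_sym_of[OF linear_refl] refl_refl refl_self
        simple_root sym_of_minus)
  then show ?thesis
    by (simp add: weyl_act_coset simple_comp_cancel zero flow_up_class_at[OF sw q])
qed

text \<open>
  The class \<open>h\<close> below measures the failure of the formula, divided by \<open>\<alpha> i\<close>. Its support would
  have to contain a vertex of rank less than that of \<open>[w]\<close>, which can only be \<open>[s\<^sub>i w]\<close>, where it is
  zero by the preceding lemma.
\<close>

lemma simple_act_down:
  assumes w: "w \<in> W" and p: "flow_up_class D J (coset D J w) p"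
    and i: "\<alpha> i \<in> out_labels J w"
    and q: "flow_up_class D J (coset D J (s i \<circ> w)) q" and v: "v \<in> W"
  shows "weyl_act (s i) p (coset D J v) = p (coset D J v) - sym_of (\<alpha> i) * q (coset D J v)"
proof -
  let ?a = "sym_of (\<alpha> i)"
  have sw: "s i \<circ> w \<in> W" by (rule comp_weyl[OF simple_refl_weyl w])
  have gkm: "gkm_class D J p" and gkm_q: "gkm_class D J q"
    using p q by (simp_all add: flow_up_class_def)
  obtain q' where q': "gkm_class D J q'"
    "\<And>w. w \<in> W \<Longrightarrow> p (coset D J w) - weyl_act (s i) p (coset D J w) = ?a * q' (coset D J w)"
    using divided_difference[OF gkm] by blast
  define h where "h X = q' X - q X" for X
  have ah: "?a * h (coset D J u) =
      (p (coset D J u) - weyl_act (s i) p (coset D J u)) - ?a * q (coset D J u)" if "u \<in> W" for u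
    by (simp add: h_def q'(2)[OF that] right_diff_distrib)
  have "h (coset D J v) = 0"
  proof (rule ccontr)
    assume ne: "h (coset D J v) \<noteq> 0"
    \<comment> \<open>the edge condition is linear in the class\<close>
    have gkm_h: "gkm_class D J h"
      unfolding gkm_class_def
    proof (intro ballI impI)
      fix u \<beta> assume u: "u \<in> W" and \<beta>: "\<beta> \<in> pos"
      have "sym_of \<beta> dvd (q' (coset D J (reflection \<beta> \<circ> u)) - q' (coset D J u))
          - (q (coset D J (reflection \<beta> \<circ> u)) - q (coset D J u))"
        using gkm_dvd[OF q'(1) u pos_root[OF \<beta>]] gkm_dvd[OF gkm_q u pos_root[OF \<beta>]] by (rule dvd_diff)
      then show "sym_of \<beta> dvd h (coset D J (reflection \<beta> \<circ> u)) - h (coset D J u)"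
        unfolding h_def by (simp only: algebra_simps)
    qed
    have hom: "homogeneous (card (out_labels J w)) (?a * h (coset D J u))" if u: "u \<in> W" for u
    proof -
      have "homogeneous (1 + card (out_labels J (s i \<circ> w))) (?a * q (coset D J u))"
        by (intro homogeneous_mult homogeneous_sym_of flow_up_class_homogeneous[OF sw q u])
      then show ?thesis
        unfolding ah[OF u] out_labels_down(4)[OF w i]
        using homogeneous_class_diff_act[OF w p u, of i] out_labels_down(4)[OF w i]
        by (metis homogeneous_diff plus_1_eq_Suc)
    qed
    obtain u where u: "u \<in> W" "h (coset D J u) \<noteq> 0" "card (out_labels J u) < card (out_labels J w)"
      using gkm_support_vertex[OF gkm_h simple_neq_0 hom v ne] by blast
    have "?a * h (coset D J u) \<noteq> 0" using u(2) linear_form_mult_eq_0 simple_neq_0 by blast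
    then have "p (coset D J u) - weyl_act (s i) p (coset D J u) \<noteq> 0 \<or> q (coset D J u) \<noteq> 0"
      unfolding ah[OF u(1)] by auto
    then have at: "coset D J u = coset D J (s i \<circ> w)"
      using flow_up_class_support_act[OF w p u(1) u(3)] flow_up_class_support[OF sw q u(1)]
        u(3) out_labels_down(4)[OF w i] by auto
    have "?a * h (coset D J u) = 0"
      unfolding at ah[OF sw] simple_act_at_lower[OF w p i q] by simp
    with \<open>?a * h (coset D J u) \<noteq> 0\<close> show False by simp
  qed
  then show ?thesis using ah[OF v] by (simp add: algebra_simps)
qed

lemma coset_less_simple_out_label:
  assumes w: "w \<in> W" and less: "coset_less D (coset D J (s i \<circ> w)) (coset D J w)"
  shows "\<alpha> i \<in> out_labels J w"
proof (rule ccontr)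
  assume no: "\<alpha> i \<notin> out_labels J w"
  have sw: "s i \<circ> w \<in> W" by (rule comp_weyl[OF simple_refl_weyl w])
  have ne: "coset D J (s i \<circ> w) \<noteq> coset D J w" using less by (simp add: coset_less_def)
  then have "\<alpha> i \<in> out_labels J (s i \<circ> w)" using simple_in_out_labels[OF w] no by blast
  then have "card (out_labels J w) < card (out_labels J (s i \<circ> w))"
    using out_labels_down(4)[OF sw] by (simp add: simple_comp_cancel)
  moreover have "card (out_labels J (s i \<circ> w)) < card (out_labels J w)"
    using coset_le_card[OF sw w] less unfolding coset_less_def by blast
  ultimately show False by simp
qed

lemma simple_coset_comparable:
  assumes w: "w \<in> W"
  shows "coset_le D (coset D J w) (coset D J (s i \<circ> w)) \<or>
    coset_less D (coset D J (s i \<circ> w)) (coset D J w)"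
proof (cases "coset D J (s i \<circ> w) = coset D J w")
  case True
  then show ?thesis using coset_le_refl by metis
next
  case ne: False
  have sw: "s i \<circ> w \<in> W" by (rule comp_weyl[OF simple_refl_weyl w])
  show ?thesis
  proof (cases "\<alpha> i \<in> out_labels J w")
    case True
    then show ?thesis using coset_le_simple[OF w] ne by (simp add: coset_less_def)
  next
    case False
    then have "\<alpha> i \<in> out_labels J (s i \<circ> w)" using simple_in_out_labels[OF w ne] by blast
    then have "coset_le D (coset D J (s i \<circ> (s i \<circ> w))) (coset D J (s i \<circ> w))"
      by (rule coset_le_simple[OF sw])
    then show ?thesis unfolding simple_comp_cancel ..
  qed
qed

end

theorem lemma4p4:
  fixes D :: "'n::finite root_data" and J :: "'n set" and i :: 'n
    and w :: "complex ^ 'n \<Rightarrow> complex ^ 'n" and p :: "'n coset \<Rightarrow> 'n sym"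
  assumes "based_root_system D"
    and "w \<in> weyl D"
    and "flow_up_class D J (coset D J w) p"
  shows "(coset_le D (coset D J w) (coset D J (simple_refl D i \<circ> w)) \<or>
          coset_less D (coset D J (simple_refl D i \<circ> w)) (coset D J w)) \<and>
    (coset_le D (coset D J w) (coset D J (simple_refl D i \<circ> w)) \<longrightarrow>
       (\<forall>X\<in>cosets D J. weyl_act (simple_refl D i) p X = p X)) \<and>
    (coset_less D (coset D J (simple_refl D i \<circ> w)) (coset D J w) \<longrightarrow>
       (\<forall>q. flow_up_class D J (coset D J (simple_refl D i \<circ> w)) q \<longrightarrow>
          (\<forall>X\<in>cosets D J.
             weyl_act (simple_refl D i) p X = p X - sym_of (simple D i) * q X)))"
proof -
  interpret based_roots D by unfold_locales (rule assms(1))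
  note w = assms(2) and p = assms(3)
  show ?thesis
  proof (intro conjI impI allI ballI)
    show "coset_le D (coset D J w) (coset D J (s i \<circ> w)) \<or>
        coset_less D (coset D J (s i \<circ> w)) (coset D J w)"
      by (rule simple_coset_comparable[OF w])
  next
    fix X assume le: "coset_le D (coset D J w) (coset D J (s i \<circ> w))" and "X \<in> cosets D J"
    then obtain v where "v \<in> W" "X = coset D J v" by (auto simp: cosets_def)
    then show "weyl_act (s i) p X = p X" using simple_act_up[OF w p le] by blast
  next
    fix q X
    assume less: "coset_less D (coset D J (s i \<circ> w)) (coset D J w)"
      and q: "flow_up_class D J (coset D J (s i \<circ> w)) q" and "X \<in> cosets D J"
    then obtain v where "v \<in> W" "X = coset D J v" by (auto simp: cosets_def)
    then show "weyl_act (s i) p X = p X - sym_of (\<alpha> i) * q X"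
      using simple_act_down[OF w p coset_less_simple_out_label[OF w less] q] by blast
  qed
qed

end
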